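(* There exists an algorithm that, given a vector $c'$ of $d'$ non-negative integers, a sparsity $k' \in \mathbb{N}_+$ and an index $j_s \in [1, d']$, outputs an integer $r$ with the following properties. Let $J = [j_s, \min\{j_s + \Delta - 1, d'\}]$. If for every optimal solution $\hat u$ of $\mathcal{P}(c',k')$ there is an index $i \in J$ with $\hat u_i = 1$, then $r \in J$ and there is an optimal solution $u^\star$ of $\mathcal{P}(c',k')$ with $u^\star_r = 1$. Otherwise $r = -1$. Furthermore, the algorithm runs in time $O\big((\log \Delta)\, d'(\log(c'_{max}+1) + \log k')\big)$, where $c'_{max} = \max_i c'_i$.
   Context: $\Delta$ is a fixed positive integer. $\mathcal{P}(c',k')$ is the problem: maximize $c'^T u$ subject to $\sum_{i=1}^{d'} u_i = k'$, $\sum_{j=i}^{\min\{i+\Delta-1,d'\}} u_j \le 1$ for all $i = 1,\dots,d'$, and $u_i \ge 0$; its constraint matrix is totally unimodular, and the (optimal) solutions considered are binary vectors $u \in \{0,1\}^{d'}$, i.e. indicator vectors of sets of $k'$ indices with pairwise distance at least $\Delta$.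
   Formalization: The output properties are proved when P(c',k') is feasible (otherwise there is no optimal solution and the claim fails); in the time bound, log Δ and log(c'_max+1)+log k' are replaced by their maximum with 1, since the literal bound is 0 for Δ=1 or for c'=0, k'=1. *)

theory Defs
  imports Complex_Main
begin

text \<open>
  The linear program \<open>\<P>(c, k)\<close>. Vectors of dimension \<open>d\<close> are functions on \<open>{1..d}\<close>; values outside
  this range are never inspected. Optimality is over all real feasible points, while the
  solutions considered are the binary ones.
\<close>

definition feasible :: "nat \<Rightarrow> nat \<Rightarrow> nat \<Rightarrow> (nat \<Rightarrow> real) \<Rightarrow> bool" where
  "feasible \<Delta> d k u \<longleftrightarrow>
     (\<Sum>i=1..d. u i) = real k \<and>
     (\<forall>i\<in>{1..d}. (\<Sum>j=i..min (i + \<Delta> - 1) d. u j) \<le> 1) \<and>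
     (\<forall>i\<in>{1..d}. 0 \<le> u i)"

definition objective :: "nat \<Rightarrow> (nat \<Rightarrow> nat) \<Rightarrow> (nat \<Rightarrow> real) \<Rightarrow> real" where
  "objective d c u = (\<Sum>i=1..d. real (c i) * u i)"

definition optimal_solution :: "nat \<Rightarrow> nat \<Rightarrow> (nat \<Rightarrow> nat) \<Rightarrow> nat \<Rightarrow> (nat \<Rightarrow> real) \<Rightarrow> bool" where
  "optimal_solution \<Delta> d c k u \<longleftrightarrow>
     feasible \<Delta> d k u \<and>
     (\<forall>v. feasible \<Delta> d k v \<longrightarrow> objective d c v \<le> objective d c u) \<and>
     (\<forall>i\<in>{1..d}. u i \<in> {0, 1})"

text \<open>
  The model of computation is a uniform-cost random access machine, presented as a structured
  language with finitely many integer registers and integer arrays per program. The arithmetic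
  is limited to addition, subtraction and halving: with multiplication at unit cost on unbounded
  integers the model would be unrealistically powerful. Every syntactic node that is evaluated
  costs one time unit.
\<close>

type_synonym name = string
type_synonym state = "(name \<Rightarrow> int) \<times> (name \<Rightarrow> int \<Rightarrow> int)"

datatype aexp =
    Const int
  | Var name
  | Read name aexp
  | Plus aexp aexp
  | Minus aexp aexp
  | Half aexp

datatype bexp =
    BLess aexp aexp
  | BEqual aexp aexp
  | BNot bexp
  | BAnd bexp bexp

datatype com =
    Skip
  | Assign name aexp
  | Write name aexp aexp
  | Seq com com
  | Cond bexp com com
  | While bexp com

fun aval :: "aexp \<Rightarrow> state \<Rightarrow> int" where
  "aval (Const n) s = n"
| "aval (Var x) s = fst s x"
| "aval (Read a e) s = snd s a (aval e s)"
| "aval (Plus e f) s = aval e s + aval f s"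
| "aval (Minus e f) s = aval e s - aval f s"
| "aval (Half e) s = aval e s div 2"

fun acost :: "aexp \<Rightarrow> nat" where
  "acost (Const n) = 1"
| "acost (Var x) = 1"
| "acost (Read a e) = acost e + 1"
| "acost (Plus e f) = acost e + acost f + 1"
| "acost (Minus e f) = acost e + acost f + 1"
| "acost (Half e) = acost e + 1"

fun bval :: "bexp \<Rightarrow> state \<Rightarrow> bool" where
  "bval (BLess e f) s \<longleftrightarrow> aval e s < aval f s"
| "bval (BEqual e f) s \<longleftrightarrow> aval e s = aval f s"
| "bval (BNot b) s \<longleftrightarrow> \<not> bval b s"
| "bval (BAnd b b') s \<longleftrightarrow> bval b s \<and> bval b' s"

fun bcost :: "bexp \<Rightarrow> nat" where
  "bcost (BLess e f) = acost e + acost f + 1"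
| "bcost (BEqual e f) = acost e + acost f + 1"
| "bcost (BNot b) = bcost b + 1"
| "bcost (BAnd b b') = bcost b + bcost b' + 1"

fun set_var :: "name \<Rightarrow> int \<Rightarrow> state \<Rightarrow> state" where
  "set_var x n (v, m) = (v(x := n), m)"

fun set_arr :: "name \<Rightarrow> int \<Rightarrow> int \<Rightarrow> state \<Rightarrow> state" where
  "set_arr a i n (v, m) = (v, m(a := (m a)(i := n)))"

text \<open>\<open>exec p s t s'\<close>: started in \<open>s\<close>, program \<open>p\<close> halts in \<open>s'\<close> after exactly \<open>t\<close> time units.\<close>

inductive exec :: "com \<Rightarrow> state \<Rightarrow> nat \<Rightarrow> state \<Rightarrow> bool" where
  Skip: "exec Skip s 1 s"
| Assign: "exec (Assign x e) s (acost e + 1) (set_var x (aval e s) s)"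
| Write: "exec (Write a e f) s (acost e + acost f + 1) (set_arr a (aval e s) (aval f s) s)"
| Seq: "exec p s t s' \<Longrightarrow> exec q s' t' s'' \<Longrightarrow> exec (Seq p q) s (t + t' + 1) s''"
| CondTrue: "bval b s \<Longrightarrow> exec p s t s' \<Longrightarrow> exec (Cond b p q) s (bcost b + t + 1) s'"
| CondFalse: "\<not> bval b s \<Longrightarrow> exec q s t s' \<Longrightarrow> exec (Cond b p q) s (bcost b + t + 1) s'"
| WhileFalse: "\<not> bval b s \<Longrightarrow> exec (While b p) s (bcost b + 1) s"
| WhileTrue: "bval b s \<Longrightarrow> exec p s t s' \<Longrightarrow> exec (While b p) s' t' s'' \<Longrightarrow>
    exec (While b p) s (bcost b + t + t' + 1) s''"

inductive_cases exec_SkipE: "exec Skip s t s'"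
inductive_cases exec_AssignE: "exec (Assign x e) s t s'"
inductive_cases exec_WriteE: "exec (Write a e f) s t s'"
inductive_cases exec_SeqE: "exec (Seq p q) s t s'"
inductive_cases exec_CondE: "exec (Cond b p q) s t s'"
inductive_cases exec_WhileE: "exec (While b p) s t s'"

lemma exec_deterministic:
  "exec p s t s' \<Longrightarrow> exec p s r s'' \<Longrightarrow> t = r \<and> s' = s''"
proof (induction arbitrary: r s'' rule: exec.induct)
  case (Skip s)
  then show ?case by (auto elim: exec_SkipE)
next
  case (Assign x e s)
  then show ?case by (auto elim: exec_AssignE)
next
  case (Write a e f s)
  then show ?case by (auto elim: exec_WriteE)
next
  case (Seq p s t s1 q t' s2)
  from Seq.prems obtain t1 s3 t2 where
    "r = t1 + t2 + 1" "exec p s t1 s3" "exec q s3 t2 s''"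
    by (auto elim: exec_SeqE)
  with Seq.IH(1)[of t1 s3] Seq.IH(2)[of t2 s''] show ?case by simp
next
  case (CondTrue b s p t s' q)
  from CondTrue.prems CondTrue.hyps(1) obtain t1 where
    "r = bcost b + t1 + 1" "exec p s t1 s''"
    by (auto elim: exec_CondE)
  with CondTrue.IH[of t1 s''] show ?case by simp
next
  case (CondFalse b s q t s' p)
  from CondFalse.prems CondFalse.hyps(1) obtain t1 where
    "r = bcost b + t1 + 1" "exec q s t1 s''"
    by (auto elim: exec_CondE)
  with CondFalse.IH[of t1 s''] show ?case by simp
next
  case (WhileFalse b s p)
  from WhileFalse.prems WhileFalse.hyps show ?case
    by (auto elim: exec_WhileE)
next
  case (WhileTrue b s p t s1 t' s2)
  from WhileTrue.prems WhileTrue.hyps(1) obtain t1 s3 t2 where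
    "r = bcost b + t1 + t2 + 1" "exec p s t1 s3" "exec (While b p) s3 t2 s''"
    by (auto elim: exec_WhileE)
  with WhileTrue.IH(1)[of t1 s3] WhileTrue.IH(2)[of t2 s''] show ?case by simp
qed

definition input_state :: "nat \<Rightarrow> nat \<Rightarrow> (nat \<Rightarrow> nat) \<Rightarrow> nat \<Rightarrow> nat \<Rightarrow> state" where
  "input_state \<Delta> d c k j =
     ((\<lambda>_. 0)(''Delta'' := int \<Delta>, ''d'' := int d, ''k'' := int k, ''j'' := int j),
      (\<lambda>_ _. 0)(''c'' := (\<lambda>i. if 1 \<le> i \<and> i \<le> int d then int (c (nat i)) else 0)))"

definition output_of :: "state \<Rightarrow> int" where
  "output_of s = fst s ''r''"

text \<open>
  The expression inside \<open>O(\<dots>)\<close>. The binary logarithms make each \<open>max 1\<close> relevant only where the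
  corresponding factor is zero (\<open>\<Delta> = 1\<close>, respectively \<open>c = 0\<close> and \<open>k = 1\<close>), in which case no running
  time could meet the bound.
\<close>

definition time_bound :: "nat \<Rightarrow> nat \<Rightarrow> (nat \<Rightarrow> nat) \<Rightarrow> nat \<Rightarrow> real" where
  "time_bound \<Delta> d c k =
     max 1 (log 2 (real \<Delta>)) * real d *
     max 1 (log 2 (real (Max (c ` {1..d})) + 1) + log 2 (real k))"

end

theory Submission
  imports Defs
begin

text \<open>
  Write \<open>H(\<mu>, b)\<close> for the maximum of \<open>\<Sum>i. (c i - \<mu>) * u i\<close> over the solutions of arbitrary cardinality
  that vanish on \<open>[j, b]\<close>; a linear dynamic program computes it, and its increments form a dual
  solution, so it also bounds the fractional solutions. Rounding a convex combination of two
  solutions along a translate of the integers shows that the best value is concave in the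
  cardinality. Its slopes are integers, so the convex function \<open>\<mu> \<mapsto> H(\<mu>, b) + \<mu> * k\<close> attains the
  optimum of the problem restricted to cardinality \<open>k\<close> as soon as the integer \<open>\<mu>\<close> is not worse than
  its two neighbours. A first binary search finds such a \<open>\<mu>\<close> for the unrestricted problem; then
  three evaluations of \<open>H\<close> decide whether some optimal solution avoids \<open>[j, b]\<close>. A second binary
  search finds the least \<open>b\<close> in the window for which none does: an optimal solution that avoids
  \<open>[j, b - 1]\<close> must then contain \<open>b\<close>.
\<close>

section \<open>Packings and rounding\<close>

definition packing :: "nat \<Rightarrow> nat \<Rightarrow> (nat \<Rightarrow> 'a::linordered_idom) \<Rightarrow> bool" where
  "packing \<Delta> d u \<longleftrightarrow>
     (\<forall>i\<in>{1..d}. (\<Sum>l=i..min (i + \<Delta> - 1) d. u l) \<le> 1) \<and> (\<forall>i\<in>{1..d}. 0 \<le> u i)"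

lemma feasible_iff_packing:
  "feasible \<Delta> d k u \<longleftrightarrow> packing \<Delta> d u \<and> (\<Sum>i=1..d. u i) = real k"
  unfolding feasible_def packing_def by auto

lemma packing_of_int:
  "packing \<Delta> d (\<lambda>i. real_of_int (x i)) \<longleftrightarrow> packing \<Delta> d x"
proof -
  have "(\<Sum>l=i..m. real_of_int (x l)) \<le> 1 \<longleftrightarrow> (\<Sum>l=i..m. x l) \<le> 1" for i m
    by (simp flip: of_int_sum)
  then show ?thesis
    unfolding packing_def by simp
qed

lemma packing_le_1:
  assumes "packing \<Delta> d u" "1 \<le> \<Delta>" "i \<in> {1..d}"
  shows "u i \<le> 1"
proof -
  have "u i \<le> (\<Sum>l=i..min (i + \<Delta> - 1) d. u l)"
    using assms by (intro member_le_sum) (auto simp: packing_def)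
  also have "\<dots> \<le> 1"
    using assms by (auto simp: packing_def)
  finally show ?thesis .
qed

lemma sum_diff_telescope:
  fixes f :: "nat \<Rightarrow> 'a::ab_group_add"
  assumes "1 \<le> m" "m \<le> Suc n"
  shows "(\<Sum>i=m..n. f i - f (i - 1)) = f n - f (m - 1)"
  using assms(2)
proof (induction n)
  case 0
  then show ?case using assms(1) by (cases "m = 1") auto
next
  case (Suc n)
  show ?case
  proof (cases "m = Suc (Suc n)")
    case False
    with Suc show ?thesis by simp
  qed simp
qed

text \<open>This is systematic sampling: for nonnegative \<open>u\<close>, entry \<open>i\<close>
  counts the integers that the prefix sum shifted by \<open>\<theta>\<close> reaches in passing
  \<open>i\<close>. As a difference of floors it telescopes over windows.\<close>

definition rounding :: "(nat \<Rightarrow> real) \<Rightarrow> real \<Rightarrow> nat \<Rightarrow> int" where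
  "rounding u \<theta> i = \<lfloor>(\<Sum>l=1..i. u l) + \<theta>\<rfloor> - \<lfloor>(\<Sum>l=1..i-1. u l) + \<theta>\<rfloor>"

lemma sum_rounding:
  assumes "1 \<le> m" "m \<le> Suc n"
  shows "(\<Sum>i=m..n. rounding u \<theta> i) =
    \<lfloor>(\<Sum>l=1..n. u l) + \<theta>\<rfloor> - \<lfloor>(\<Sum>l=1..m-1. u l) + \<theta>\<rfloor>"
  unfolding rounding_def using assms by (rule sum_diff_telescope)

lemma sum_split_prefix:
  fixes u :: "nat \<Rightarrow> 'a::comm_monoid_add"
  assumes "1 \<le> m" "m \<le> Suc n"
  shows "(\<Sum>l=1..n. u l) = (\<Sum>l=1..m-1. u l) + (\<Sum>l=m..n. u l)"
proof -
  have "{1..n} = {1..m-1} \<union> {m..n}" "{1..m-1} \<inter> {m..n} = {}"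
    using assms by auto
  then show ?thesis
    by (simp add: sum.union_disjoint)
qed

text \<open>A window of fractional weight at most 1 covers at most one point of a translate of the
  integers.\<close>

lemma packing_rounding:
  assumes u: "packing \<Delta> d u"
  shows "packing \<Delta> d (rounding u \<theta>)"
  unfolding packing_def
proof (intro conjI ballI)
  fix i assume i: "i \<in> {1..d}"
  let ?m = "min (i + \<Delta> - 1) d"
  have im: "1 \<le> i" "i \<le> Suc ?m"
    using i by auto
  have "(\<Sum>l=1..?m. u l) + \<theta> \<le> (\<Sum>l=1..i-1. u l) + \<theta> + 1"
    using sum_split_prefix[OF im, of u] u i by (auto simp: packing_def)
  then have "\<lfloor>(\<Sum>l=1..?m. u l) + \<theta>\<rfloor> \<le> \<lfloor>(\<Sum>l=1..i-1. u l) + \<theta>\<rfloor> + 1"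
    by linarith
  then show "(\<Sum>l=i..?m. rounding u \<theta> l) \<le> 1"
    using sum_rounding[OF im, of u \<theta>] by simp
  have "(\<Sum>l=1..i-1. u l) \<le> (\<Sum>l=1..i. u l)"
    using sum_split_prefix[of i i u] u i by (auto simp: packing_def)
  then show "0 \<le> rounding u \<theta> i"
    by (simp add: rounding_def floor_mono)
qed

lemma sum_rounding_eq:
  assumes "(\<Sum>i=1..d. u i) = real_of_int n" "0 \<le> \<theta>" "\<theta> < 1"
  shows "(\<Sum>i=1..d. rounding u \<theta> i) = n"
proof -
  have "\<lfloor>real_of_int n + \<theta>\<rfloor> = n" "\<lfloor>\<theta>\<rfloor> = 0"
    using assms by linarith+
  then show ?thesis
    using sum_rounding[of 1 d u \<theta>] assms by simp
qed

lemma rounding_eq_0: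
  assumes "1 \<le> i" "u i = 0"
  shows "rounding u \<theta> i = 0"
  using sum_split_prefix[of i i u] assms by (simp add: rounding_def)

text \<open>Raising \<open>a\<close> by 1 drops the term at \<open>t = 0\<close> and adds the one at
  \<open>t = q\<close>, which is larger by exactly 1. Iterating this gives a form of Hermite's
  identity.\<close>

lemma sum_floor_shift:
  fixes a :: int
  assumes "0 < q"
  shows "(\<Sum>t<q. (a + int m + int t) div int q) = (\<Sum>t<q. (a + int t) div int q) + int m"
proof (induction m)
  case (Suc m)
  let ?f = "\<lambda>t. (a + int m + int t) div int q"
  have "(\<Sum>t<q. ?f (Suc t)) - (\<Sum>t<q. ?f t) = ?f q - ?f 0"
    using sum_lessThan_telescope[of ?f q] by (simp only: sum_subtractf)
  also have "\<dots> = 1"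
    using assms by simp
  finally show ?case
    using Suc by (simp add: algebra_simps)
qed simp

text \<open>Equally spaced shifts are unbiased: the \<open>q\<close> roundings of
  \<open>y / q\<close> add up to \<open>y\<close>. The prefix sums are multiples of
  \<open>1 / q\<close>, so the floors become \<open>div\<close> and \<open>sum_floor_shift\<close>
  counts the crossings.\<close>

lemma sum_rounding_average:
  fixes y :: "nat \<Rightarrow> int"
  assumes q: "0 < q" and i: "1 \<le> i" and y: "0 \<le> y i"
  shows "(\<Sum>t<q. rounding (\<lambda>l. real_of_int (y l) / real q) (real t / real q) i) = y i"
proof -
  have fl: "\<lfloor>(\<Sum>l=1..m. real_of_int (y l) / real q) + real t / real q\<rfloor> =
      ((\<Sum>l=1..m. y l) + int t) div int q" for m t
  proof -
    have "(\<Sum>l=1..m. real_of_int (y l) / real q) + real t / real q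
        = real_of_int ((\<Sum>l=1..m. y l) + int t) / real_of_int (int q)"
      by (simp add: add_divide_distrib flip: sum_divide_distrib)
    then show ?thesis
      by (simp only: floor_divide_of_int_eq)
  qed
  have "(\<Sum>l=1..i. y l) = (\<Sum>l=1..i-1. y l) + int (nat (y i))"
    using sum_split_prefix[of i i y] i y by simp
  then show ?thesis
    unfolding rounding_def fl sum_subtractf
    using sum_floor_shift[OF q, of "\<Sum>l=1..i-1. y l" "nat (y i)"] y by simp
qed

lemma sum_ge_imp_ex_ge:
  fixes f :: "nat \<Rightarrow> int"
  assumes "0 < q" "int q * W \<le> (\<Sum>t<q. f t)"
  shows "\<exists>t<q. W \<le> f t"
proof (rule ccontr)
  assume "\<not> ?thesis"
  then have "(\<Sum>t<q. f t) < (\<Sum>t<q. W)"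
    using assms(1) by (intro sum_strict_mono) auto
  then show False
    using assms(2) by simp
qed

text \<open>Concavity in the cardinality: round the convex combination of \<open>x\<close> and \<open>y\<close> of total weight
  \<open>n\<close>.\<close>

lemma packing_interpolate:
  fixes x y :: "nat \<Rightarrow> int"
  assumes x: "packing \<Delta> d x" and y: "packing \<Delta> d y"
    and sx: "(\<Sum>i=1..d. x i) = a" and sy: "(\<Sum>i=1..d. y i) = b"
    and n: "a \<le> n" "n \<le> b" and ab: "a < b"
  shows "\<exists>z. packing \<Delta> d z \<and> (\<Sum>i=1..d. z i) = n \<and>
     (\<forall>i\<in>{1..d}. x i = 0 \<longrightarrow> y i = 0 \<longrightarrow> z i = 0) \<and>
     (b - n) * (\<Sum>i=1..d. w i * x i) + (n - a) * (\<Sum>i=1..d. w i * y i)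
       \<le> (b - a) * (\<Sum>i=1..d. w i * z i)"
proof -
  \<comment> \<open>The common denominator of the convex combination. Clearing it keeps
    \<open>v\<close> integral, which the averaging over \<open>q\<close> shifts requires.\<close>
  define q where "q = nat (b - a)"
  have q: "0 < q" "int q = b - a"
    using ab by (auto simp: q_def)
  have rq: "real q = real_of_int (b - a)"
    using q(2) by (metis of_int_of_nat_eq)
  define v where "v i = (b - n) * x i + (n - a) * y i" for i
  define u where "u i = real_of_int (v i) / real q" for i
  have v_nonneg: "0 \<le> v i" if "i \<in> {1..d}" for i
    using x y n that by (auto simp: v_def packing_def)
  have "(\<Sum>l=i..m. v l) \<le> int q" if "(\<Sum>l=i..m. x l) \<le> 1" "(\<Sum>l=i..m. y l) \<le> 1" for i m
  proof -
    have "(\<Sum>l=i..m. v l) = (b - n) * (\<Sum>l=i..m. x l) + (n - a) * (\<Sum>l=i..m. y l)"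
      by (simp add: v_def sum.distrib sum_distrib_left)
    also have "\<dots> \<le> (b - n) * 1 + (n - a) * 1"
      using that n by (intro add_mono mult_left_mono) auto
    finally show ?thesis using q by simp
  qed
  moreover have "(\<Sum>l=i..m. u l) = real_of_int (\<Sum>l=i..m. v l) / real q" for i m
    by (simp add: u_def sum_divide_distrib)
  ultimately have "(\<Sum>l=i..m. u l) \<le> 1" if "(\<Sum>l=i..m. x l) \<le> 1" "(\<Sum>l=i..m. y l) \<le> 1" for i m
    using that q(1) by (metis divide_le_eq_1 of_int_le_iff of_int_of_nat_eq of_nat_0_less_iff)
  then have u: "packing \<Delta> d u"
    using x y v_nonneg by (auto simp: packing_def u_def)
  have "(\<Sum>i=1..d. v i) = (b - n) * a + (n - a) * b"
    by (simp add: v_def sum.distrib flip: sum_distrib_left sx sy)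
  also have "\<dots> = n * (b - a)"
    by (simp add: algebra_simps)
  finally have "(\<Sum>i=1..d. u i) = real_of_int (n * (b - a)) / real q"
    by (simp add: u_def flip: sum_divide_distrib of_int_sum)
  then have su: "(\<Sum>i=1..d. u i) = real_of_int n"
    using q ab by (simp add: rq)
  let ?z = "\<lambda>t. rounding u (real t / real q)"
  \<comment> \<open>Over all shifts together the roundings weigh as much as \<open>v\<close>, so
    some shift reaches the average. A factor \<open>int q\<close> on both sides avoids
    division.\<close>
  have "(\<Sum>t<q. \<Sum>i=1..d. w i * ?z t i) = (\<Sum>i=1..d. w i * (\<Sum>t<q. ?z t i))"
    by (simp add: sum.swap[of _ "{..<q}"] sum_distrib_left)
  also have "\<dots> = (\<Sum>i=1..d. w i * v i)"
    using q(1) v_nonneg by (intro sum.cong) (auto simp: u_def[abs_def] sum_rounding_average)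
  finally have "(\<Sum>t<q. \<Sum>i=1..d. w i * ?z t i) = (\<Sum>i=1..d. w i * v i)" .
  then have "int q * (\<Sum>i=1..d. w i * v i) = (\<Sum>t<q. int q * (\<Sum>i=1..d. w i * ?z t i))"
    by (simp flip: sum_distrib_left)
  from sum_ge_imp_ex_ge[OF q(1) eq_refl[OF this]] obtain t where t: "t < q"
    "(\<Sum>i=1..d. w i * v i) \<le> int q * (\<Sum>i=1..d. w i * ?z t i)"
    by blast
  have "(\<Sum>i=1..d. w i * v i) =
      (b - n) * (\<Sum>i=1..d. w i * x i) + (n - a) * (\<Sum>i=1..d. w i * y i)"
    unfolding sum_distrib_left sum.distrib[symmetric]
    by (intro sum.cong) (auto simp: v_def algebra_simps)
  moreover have "(\<Sum>i=1..d. ?z t i) = n"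
    using t(1) by (intro sum_rounding_eq su) auto
  moreover have "?z t i = 0" if "i \<in> {1..d}" "x i = 0" "y i = 0" for i
    using that by (intro rounding_eq_0) (auto simp: u_def v_def)
  ultimately show ?thesis
    using t packing_rounding[OF u] q(2) by (intro exI[of _ "?z t"]) auto
qed

text \<open>Moving the cardinality one unit at a time loses less than 1 in value, hence nothing.\<close>

lemma maximizer_of_size:
  fixes W s :: "'b \<Rightarrow> int"
  assumes ip: "\<And>x y n. x \<in> P \<Longrightarrow> y \<in> P \<Longrightarrow> s x \<le> n \<Longrightarrow> n \<le> s y \<Longrightarrow> s x < s y \<Longrightarrow>
      \<exists>z\<in>P. s z = n \<and> (s y - n) * W x + (n - s x) * W y \<le> (s y - s x) * W z"
    and le: "\<And>x. x \<in> P \<Longrightarrow> W x \<le> M"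
    and m: "m \<in> P" "W m = M" "s m \<le> k"
    and y: "y \<in> P" "M + k \<le> W y + s y"
  shows "\<exists>z\<in>P. s z = k \<and> W z = M"
  using m
proof (induction "nat (k - s m)" arbitrary: m)
  case 0
  then show ?case by (intro bexI[of _ m]) auto
next
  case (Suc e)
  have sy: "k \<le> s y"
    using le[OF y(1)] y(2) by simp
  have sm: "s m < k"
    using Suc.hyps(2) by linarith
  obtain z where z: "z \<in> P" "s z = s m + 1"
      "(s y - (s m + 1)) * W m + ((s m + 1) - s m) * W y \<le> (s y - s m) * W z"
    using ip[of m y "s m + 1"] Suc.prems(1) y(1) sm sy by auto
  \<comment> \<open>One step from \<open>m\<close> towards \<open>y\<close> loses at most
    \<open>(s y - k) / (s y - s m)\<close>, which is below 1 because \<open>s m < k\<close>.\<close>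
  have "(s y - s m) * (M - 1) < (s y - s m) * M - (s y - k)"
    using sm by (simp add: algebra_simps)
  also have "\<dots> \<le> (s y - s m) * W z"
    using z(3) y(2) Suc.prems(2) by (simp add: algebra_simps)
  finally have "M - 1 < W z"
    using sm sy by (simp add: mult_less_cancel_left)
  then have "W z = M"
    using le[OF z(1)] by simp
  then show ?case
    using Suc.hyps z sm by (intro Suc.hyps(1)[of z]) auto
qed

section \<open>The dynamic program\<close>

text \<open>Writing \<open>i - (\<Delta> - 1)\<close> instead of \<open>Suc i - \<Delta>\<close>
  makes the recursion terminate for every \<open>\<Delta>\<close>. For
  \<open>\<Delta> \<ge> 1\<close> the two agree, and truncation at 0 stands for the empty
  prefix.\<close>

fun opt_value :: "nat \<Rightarrow> (nat \<Rightarrow> int) \<Rightarrow> nat set \<Rightarrow> nat \<Rightarrow> int" where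
  "opt_value \<Delta> w A 0 = 0"
| "opt_value \<Delta> w A (Suc i) =
    (if Suc i \<in> A then max (opt_value \<Delta> w A i) (opt_value \<Delta> w A (i - (\<Delta> - 1)) + w (Suc i))
     else opt_value \<Delta> w A i)"

lemma opt_value_mono: "mono (opt_value \<Delta> w A)"
  by (rule mono_iff_le_Suc[THEN iffD2]) auto

lemma opt_value_diff_ge:
  assumes "1 \<le> \<Delta>" "1 \<le> i" "i \<in> A"
  shows "w i \<le> opt_value \<Delta> w A i - opt_value \<Delta> w A (i - \<Delta>)"
proof -
  obtain i' where i': "i = Suc i'"
    using assms(2) by (cases i) auto
  then have eq: "i - \<Delta> = i' - (\<Delta> - 1)"
    using assms(1) by auto
  show ?thesis
    unfolding eq using assms(3) i' by simp
qed

text \<open>The increments of \<open>opt_value\<close> are a feasible dual solution.\<close>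

lemma packing_le_opt_value:
  assumes \<Delta>: "1 \<le> \<Delta>" and u: "packing \<Delta> d u" and A: "\<And>i. i \<in> {1..d} \<Longrightarrow> i \<notin> A \<Longrightarrow> u i = 0"
  shows "(\<Sum>i=1..d. real_of_int (w i) * u i) \<le> real_of_int (opt_value \<Delta> w A d)"
proof -
  define D where "D = opt_value \<Delta> w A"
  \<comment> \<open>\<open>g l\<close> is the dual variable of the window constraint that starts at
    \<open>l\<close>.\<close>
  define g where "g l = real_of_int (D l - D (l - 1))" for l
  have g_nonneg: "0 \<le> g l" for l
    using opt_value_mono[of \<Delta> w A] by (auto simp: g_def D_def monoD)
  have "(\<Sum>i=1..d. real_of_int (w i) * u i) \<le> (\<Sum>i=1..d. real_of_int (D i - D (i - \<Delta>)) * u i)"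
  proof (rule sum_mono)
    fix i assume i: "i \<in> {1..d}"
    show "real_of_int (w i) * u i \<le> real_of_int (D i - D (i - \<Delta>)) * u i"
    proof (cases "i \<in> A")
      case True
      then have "w i \<le> D i - D (i - \<Delta>)"
        using opt_value_diff_ge[OF \<Delta>] i by (auto simp: D_def)
      then show ?thesis
        using u i by (intro mult_right_mono) (auto simp: packing_def simp flip: of_int_diff)
    qed (use A i in auto)
  qed
  \<comment> \<open>The windows containing \<open>i\<close> start in
    \<open>(i - \<Delta>, i]\<close>, so their dual variables telescope to
    \<open>D i - D (i - \<Delta>)\<close>.\<close>
  also have "\<dots> = (\<Sum>i=1..d. \<Sum>l | l \<in> {1..d} \<and> (l \<le> i \<and> i < l + \<Delta>). g l * u i)"
  proof (rule sum.cong)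
    fix i assume i: "i \<in> {1..d}"
    have set: "{l. l \<in> {1..d} \<and> (l \<le> i \<and> i < l + \<Delta>)} = {Suc (i - \<Delta>)..i}"
      using i by auto
    have "(\<Sum>l=Suc (i - \<Delta>)..i. g l) = real_of_int (\<Sum>l=Suc (i - \<Delta>)..i. D l - D (l - 1))"
      by (simp add: g_def)
    also have "\<dots> = real_of_int (D i - D (i - \<Delta>))"
      by (subst sum_diff_telescope) auto
    finally show "real_of_int (D i - D (i - \<Delta>)) * u i =
        (\<Sum>l | l \<in> {1..d} \<and> (l \<le> i \<and> i < l + \<Delta>). g l * u i)"
      unfolding set by (simp flip: sum_distrib_right)
  qed simp
  also have "\<dots> = (\<Sum>l=1..d. \<Sum>i | i \<in> {1..d} \<and> (l \<le> i \<and> i < l + \<Delta>). g l * u i)"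
    by (rule sum.swap_restrict) auto
  \<comment> \<open>After the exchange of sums, each window carries weight at most 1 and costs at
    most \<open>g l\<close>.\<close>
  also have "\<dots> \<le> (\<Sum>l=1..d. g l)"
  proof (rule sum_mono)
    fix l assume l: "l \<in> {1..d}"
    have set: "{i. i \<in> {1..d} \<and> (l \<le> i \<and> i < l + \<Delta>)} = {l..min (l + \<Delta> - 1) d}"
      using l by auto
    have "g l * (\<Sum>i=l..min (l + \<Delta> - 1) d. u i) \<le> g l * 1"
      using u l g_nonneg by (intro mult_left_mono) (auto simp: packing_def)
    then show "(\<Sum>i | i \<in> {1..d} \<and> (l \<le> i \<and> i < l + \<Delta>). g l * u i) \<le> g l"
      unfolding set by (simp add: sum_distrib_left)
  qed
  also have "\<dots> = real_of_int (\<Sum>l=1..d. D l - D (l - 1))"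
    by (simp add: g_def)
  also have "\<dots> = real_of_int (D d)"
    by (subst sum_diff_telescope) (auto simp: D_def)
  finally show ?thesis by (simp add: D_def)
qed

text \<open>Traces the recursion back: \<open>n\<close> is skipped when the value does not change,
  and otherwise taken together with an optimal set that ends at least \<open>\<Delta>\<close> before
  it.\<close>

lemma spaced_set_opt_value:
  assumes "1 \<le> \<Delta>"
  shows "\<exists>X. X \<subseteq> {1..n} \<inter> A \<and> (\<forall>i\<in>X. \<forall>l\<in>X. i < l \<longrightarrow> i + \<Delta> \<le> l) \<and> sum w X = opt_value \<Delta> w A n"
proof (induction n rule: less_induct)
  case (less n)
  show ?case
  proof (cases n)
    case 0
    then show ?thesis by (intro exI[of _ "{}"]) auto
  next
    case (Suc i)
    show ?thesis
    proof (cases "opt_value \<Delta> w A n = opt_value \<Delta> w A i")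
      case True
      moreover obtain X where "X \<subseteq> {1..i} \<inter> A" "\<forall>i\<in>X. \<forall>l\<in>X. i < l \<longrightarrow> i + \<Delta> \<le> l"
          "sum w X = opt_value \<Delta> w A i"
        using less[of i] Suc by auto
      moreover have "{1..i} \<subseteq> {1..n}"
        using Suc by auto
      ultimately show ?thesis
        by (intro exI[of _ X]) auto
    next
      case False
      then have n: "n \<in> A" "opt_value \<Delta> w A n = opt_value \<Delta> w A (i - (\<Delta> - 1)) + w n"
        using Suc by (auto simp: max_def split: if_splits)
      obtain X where X: "X \<subseteq> {1..i - (\<Delta> - 1)} \<inter> A" "\<forall>i\<in>X. \<forall>l\<in>X. i < l \<longrightarrow> i + \<Delta> \<le> l"
          "sum w X = opt_value \<Delta> w A (i - (\<Delta> - 1))"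
        using less[of "i - (\<Delta> - 1)"] Suc by (metis diff_le_self le_imp_less_Suc)
      have far: "l + \<Delta> \<le> n" "l < n" "1 \<le> l" "l \<in> A" if "l \<in> X" for l
        using X(1) that Suc assms by (auto dest!: subsetD[of X _ l])
      then have "n \<notin> X" "finite X"
        using X(1) finite_subset[of X "{1..i - (\<Delta> - 1)}"] by auto
      then have "sum w (insert n X) = opt_value \<Delta> w A n"
        using X(3) n(2) by simp
      moreover have "insert n X \<subseteq> {1..n} \<inter> A"
        using far n(1) Suc by fastforce
      moreover have "\<forall>i\<in>insert n X. \<forall>l\<in>insert n X. i < l \<longrightarrow> i + \<Delta> \<le> l"
        using far X(2) by (auto dest: less_asym)
      ultimately show ?thesis by blast
    qed
  qed
qed

text \<open>A window has length at most \<open>\<Delta>\<close> and thus meets a spaced set at most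
  once, so the indicator of the set is a packing. The bound of \<open>packing_le_opt_value\<close>
  is therefore tight.\<close>

lemma packing_attains_opt_value:
  assumes "1 \<le> \<Delta>"
  shows "\<exists>x::nat \<Rightarrow> int. packing \<Delta> d x \<and> (\<forall>i. i \<notin> A \<longrightarrow> x i = 0) \<and>
    (\<Sum>i=1..d. w i * x i) = opt_value \<Delta> w A d"
proof -
  obtain X where X: "X \<subseteq> {1..d} \<inter> A" "\<forall>i\<in>X. \<forall>l\<in>X. i < l \<longrightarrow> i + \<Delta> \<le> l"
      "sum w X = opt_value \<Delta> w A d"
    using spaced_set_opt_value[OF assms, of d A w] by (elim exE conjE)
  define x :: "nat \<Rightarrow> int" where "x i = (if i \<in> X then 1 else 0)" for i
  have win: "(\<Sum>l=i..min (i + \<Delta> - 1) d. x l) \<le> 1" for i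
  proof -
    let ?W = "{i..min (i + \<Delta> - 1) d}"
    have less: "\<not> a < b" if "a \<in> X" "b \<in> X" "a \<in> ?W" "b \<in> ?W" for a b
      using that X(2)[rule_format, of a b] assms by auto
    have "a = b" if "a \<in> ?W \<inter> X" "b \<in> ?W \<inter> X" for a b
      using that less[of a b] less[of b a] by (cases a b rule: linorder_cases) blast+
    then have "card (?W \<inter> X) \<le> 1"
      by (intro card_le_Suc0_iff_eq[THEN iffD2, folded One_nat_def]) auto
    moreover have "(\<Sum>l\<in>?W. x l) = int (card (?W \<inter> X))"
      unfolding x_def by (subst sum.inter_restrict[symmetric]) auto
    ultimately show ?thesis
      by linarith
  qed
  have "(\<Sum>i=1..d. w i * x i) = (\<Sum>i=1..d. if i \<in> X then w i else 0)"
    by (intro sum.cong) (auto simp: x_def)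
  also have "\<dots> = sum w ({1..d} \<inter> X)"
    by (subst sum.inter_restrict) auto
  also have "{1..d} \<inter> X = X"
    using X(1) by auto
  finally have "(\<Sum>i=1..d. w i * x i) = opt_value \<Delta> w A d"
    using X(3) by simp
  moreover have "packing \<Delta> d x"
    using win by (auto simp: packing_def x_def)
  moreover have "x i = 0" if "i \<notin> A" for i
    using X(1) that by (auto simp: x_def)
  ultimately show ?thesis
    by (intro exI[of _ x] conjI allI impI)
qed

section \<open>Lagrangian duality\<close>

locale sparse_problem =
  fixes \<Delta> d k j :: nat and c :: "nat \<Rightarrow> nat"
  assumes \<Delta>: "1 \<le> \<Delta>" and k: "1 \<le> k" and j: "j \<in> {1..d}"
begin

text \<open>The bound is an integer, like the program register that holds it;
  \<open>int j - 1\<close> encodes that nothing is blocked.\<close>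

definition blocked :: "int \<Rightarrow> nat set" where
  "blocked b = {i. int j \<le> int i \<and> int i \<le> b}"

text \<open>The Lagrangian relaxation of the cardinality constraint, called
  \<open>H(\<mu>, b)\<close> above. The constant \<open>\<mu> * k\<close> is left out, which keeps
  multiplication out of the program.\<close>

definition dual :: "int \<Rightarrow> int \<Rightarrow> int" where
  "dual \<mu> b = opt_value \<Delta> (\<lambda>i. int (c i) - \<mu>) (- blocked b) d"

definition sols :: "int \<Rightarrow> (nat \<Rightarrow> int) set" where
  "sols b = {x. packing \<Delta> d x \<and> (\<forall>i\<in>{1..d} \<inter> blocked b. x i = 0)}"

definition val :: "(nat \<Rightarrow> int) \<Rightarrow> int" where
  "val x = (\<Sum>i=1..d. int (c i) * x i)"

definition total :: "(nat \<Rightarrow> int) \<Rightarrow> int" where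
  "total x = (\<Sum>i=1..d. x i)"

lemma blocked_empty: "blocked (int j - 1) = {}"
  by (auto simp: blocked_def)

text \<open>Weak duality. It covers all real feasible points, as optimality in the problem
  demands.\<close>

lemma objective_le_dual:
  assumes "feasible \<Delta> d n u" "\<forall>i\<in>{1..d} \<inter> blocked b. u i = 0"
  shows "objective d c u \<le> real_of_int (dual \<mu> b) + real_of_int \<mu> * real n"
proof -
  have "(\<Sum>i=1..d. real_of_int (int (c i) - \<mu>) * u i) \<le> real_of_int (dual \<mu> b)"
    unfolding dual_def using assms \<Delta> by (intro packing_le_opt_value) (auto simp: feasible_iff_packing)
  moreover have "(\<Sum>i=1..d. real_of_int (int (c i) - \<mu>) * u i) =
      objective d c u - real_of_int \<mu> * (\<Sum>i=1..d. u i)"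
    by (simp add: objective_def algebra_simps sum_subtractf sum_distrib_left)
  ultimately show ?thesis
    using assms(1) by (simp add: feasible_iff_packing)
qed

lemma val_minus_total: "(\<Sum>i=1..d. (int (c i) - \<mu>) * x i) = val x - \<mu> * total x"
  by (simp add: val_def total_def algebra_simps sum_subtractf sum_distrib_left)

lemma total_nonneg: "x \<in> sols b \<Longrightarrow> 0 \<le> total x"
  by (auto simp: total_def sols_def packing_def intro!: sum_nonneg)

lemma feasible_of_sol:
  assumes "x \<in> sols b" "total x = int n"
  shows "feasible \<Delta> d n (\<lambda>i. real_of_int (x i))"
proof -
  have "(\<Sum>i=1..d. real_of_int (x i)) = real_of_int (total x)"
    by (simp add: total_def)
  then show ?thesis
    using assms by (simp add: feasible_iff_packing packing_of_int sols_def)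
qed

lemma objective_of_int: "objective d c (\<lambda>i. real_of_int (x i)) = real_of_int (val x)"
  by (simp add: objective_def val_def)

lemma val_le_dual:
  assumes "x \<in> sols b"
  shows "val x - \<mu> * total x \<le> dual \<mu> b"
proof -
  have "real_of_int (val x) \<le> real_of_int (dual \<mu> b) + real_of_int \<mu> * real (nat (total x))"
    using objective_le_dual[OF feasible_of_sol[OF assms, of "nat (total x)"]] assms total_nonneg[OF assms]
    by (auto simp: objective_of_int sols_def)
  also have "real (nat (total x)) = real_of_int (total x)"
    using total_nonneg[OF assms] by simp
  finally have "val x \<le> dual \<mu> b + \<mu> * total x"
    by (simp only: flip: of_int_mult of_int_add of_int_le_iff[where 'a = real])
  then show ?thesis by simp
qed

lemma dual_attained: "\<exists>x\<in>sols b. val x - \<mu> * total x = dual \<mu> b"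
proof -
  obtain x where "packing \<Delta> d x" "\<forall>i. i \<notin> - blocked b \<longrightarrow> x i = 0"
      "(\<Sum>i=1..d. (int (c i) - \<mu>) * x i) = dual \<mu> b"
    unfolding dual_def
    using packing_attains_opt_value[OF \<Delta>, of d "- blocked b" "\<lambda>i. int (c i) - \<mu>"]
    by (elim exE conjE)
  then show ?thesis
    unfolding val_minus_total sols_def by blast
qed

text \<open>Interpolation preserves common zeros, so it never leaves the solutions that avoid the
  blocked indices.\<close>

lemma sols_interpolate:
  assumes "x \<in> sols b" "y \<in> sols b" "total x \<le> n" "n \<le> total y" "total x < total y"
  shows "\<exists>z\<in>sols b. total z = n \<and> (total y - n) * (val x - \<mu> * total x) +
    (n - total x) * (val y - \<mu> * total y) \<le> (total y - total x) * (val z - \<mu> * total z)"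
proof -
  obtain z where z: "packing \<Delta> d z" "total z = n" "\<forall>i\<in>{1..d}. x i = 0 \<longrightarrow> y i = 0 \<longrightarrow> z i = 0"
      "(total y - n) * (val x - \<mu> * total x) + (n - total x) * (val y - \<mu> * total y)
        \<le> (total y - total x) * (val z - \<mu> * total z)"
    using packing_interpolate[of \<Delta> d x y "total x" "total y" n "\<lambda>i. int (c i) - \<mu>"] assms
    unfolding val_minus_total by (auto simp: total_def sols_def)
  then show ?thesis
    using assms by (intro bexI[of _ z]) (auto simp: sols_def)
qed

text \<open>Since all breakpoints of the convex function \<open>\<lambda>\<mu>. dual \<mu> b + \<mu> * k\<close> are integers, a local
  minimum on the integers is a minimum on the reals; hence strong duality.\<close>

lemma strong_duality:
  assumes "dual \<mu> b + int k \<le> dual (\<mu> - 1) b" "dual \<mu> b - int k \<le> dual (\<mu> + 1) b"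
  shows "\<exists>x\<in>sols b. total x = int k \<and> val x = dual \<mu> b + \<mu> * int k"
proof -
  let ?W = "\<lambda>x. val x - \<mu> * total x"
  \<comment> \<open>Maximizers for \<open>\<mu>\<close> and its two neighbours. Measured with
    \<open>?W\<close>, the neighbours give \<open>?W y + total y = dual (\<mu> - 1) b\<close> and
    \<open>?W x - total x = dual (\<mu> + 1) b\<close>.\<close>
  obtain m where m: "m \<in> sols b" "?W m = dual \<mu> b"
    using dual_attained by blast
  obtain y where y: "y \<in> sols b" "val y - (\<mu> - 1) * total y = dual (\<mu> - 1) b"
    using dual_attained by blast
  obtain x where x: "x \<in> sols b" "val x - (\<mu> + 1) * total x = dual (\<mu> + 1) b"
    using dual_attained by blast
  have "\<exists>z\<in>sols b. total z = int k \<and> ?W z = dual \<mu> b"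
  proof (cases "total m \<le> int k")
    case True
    show ?thesis
      by (rule maximizer_of_size[where m = m and y = y])
        (use sols_interpolate val_le_dual m y True assms in \<open>auto simp: algebra_simps\<close>)
  next
    case False
    \<comment> \<open>Negating the cardinality turns the descent from \<open>m\<close> to
      \<open>k\<close> into the ascent of \<open>maximizer_of_size\<close>.\<close>
    have "\<exists>z\<in>sols b. - total z = - int k \<and> ?W z = dual \<mu> b"
    proof (rule maximizer_of_size[where m = m and y = x and s = "\<lambda>x. - total x"])
      fix x y n assume xy: "x \<in> sols b" "y \<in> sols b" "- total x \<le> n" "n \<le> - total y" "- total x < - total y"
      obtain z where "z \<in> sols b" "total z = - n" "(total x - (- n)) * ?W y +
          (- n - total y) * ?W x \<le> (total x - total y) * ?W z"
        using sols_interpolate[of y b x "- n" \<mu>] xy by auto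
      then show "\<exists>z\<in>sols b. - total z = n \<and> (- total y - n) * ?W x + (n - - total x) * ?W y
          \<le> (- total y - - total x) * ?W z"
        by (intro bexI[of _ z]) (auto simp: algebra_simps)
    qed (use val_le_dual m x False assms in \<open>auto simp: algebra_simps\<close>)
    then show ?thesis by simp
  qed
  then obtain z where "z \<in> sols b" "total z = int k" "?W z = dual \<mu> b"
    by blast
  then show ?thesis
    by (intro bexI[of _ z]) auto
qed

section \<open>Bracketing an optimal multiplier\<close>

lemma sol_of_feasible:
  assumes "feasible \<Delta> d k u"
  shows "\<exists>x\<in>sols (int j - 1). total x = int k"
proof (intro bexI)
  have u: "packing \<Delta> d u" "(\<Sum>i=1..d. u i) = real_of_int (int k)"
    using assms by (auto simp: feasible_iff_packing)
  show "total (rounding u 0) = int k"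
    unfolding total_def using u(2) by (rule sum_rounding_eq) auto
  show "rounding u 0 \<in> sols (int j - 1)"
    using packing_rounding[OF u(1)] by (simp add: sols_def blocked_empty)
qed

text \<open>Below \<open>- k * M\<close> one more unit of cardinality outweighs all values that
  fewer than \<open>k\<close> entries can collect. Hence a maximizer has total at least
  \<open>k\<close>, and lowering the multiplier by 1 gains at least \<open>k\<close>.\<close>

lemma dual_step_low:
  assumes "feasible \<Delta> d k u" and M: "\<And>i. i \<in> {1..d} \<Longrightarrow> int (c i) \<le> M" "0 \<le> M" and L: "int k * M < L"
  shows "dual (- L) (int j - 1) + int k \<le> dual (- L - 1) (int j - 1)"
proof -
  let ?b = "int j - 1"
  obtain z where z: "z \<in> sols ?b" "total z = int k"
    using sol_of_feasible[OF assms(1)] by blast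
  obtain x where x: "x \<in> sols ?b" "val x + L * total x = dual (- L) ?b"
    using dual_attained[of ?b "- L"] by auto
  have "0 \<le> val z"
    using z(1) by (auto simp: val_def sols_def packing_def intro!: sum_nonneg)
  then have 1: "L * int k \<le> val x + L * total x"
    using val_le_dual[OF z(1), of "- L"] z(2) x(2) by simp
  have "val x \<le> (\<Sum>i=1..d. M * x i)"
    unfolding val_def using x(1) M(1) by (intro sum_mono mult_right_mono) (auto simp: sols_def packing_def)
  then have 2: "val x \<le> M * total x"
    by (simp add: total_def sum_distrib_left)
  have "int k \<le> total x"
  proof (rule ccontr)
    assume "\<not> int k \<le> total x"
    then have s: "total x \<le> int k - 1" by simp
    have "0 \<le> L"
      using L M(2) by (smt (verit) mult_nonneg_nonneg of_nat_0_le_iff)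
    then have "L * total x \<le> L * (int k - 1)" "M * total x \<le> M * int k"
      using s M(2) by (auto intro!: mult_left_mono)
    then show False
      using 1 2 L by (simp add: algebra_simps)
  qed
  then show ?thesis
    using val_le_dual[OF x(1), of "- L - 1"] x(2) by (simp add: algebra_simps)
qed

text \<open>At multiplier \<open>M\<close> no weight is positive, so
  \<open>dual M b \<le> 0\<close>, while the zero vector shows
  \<open>0 \<le> dual (M + 1) b\<close>.\<close>

lemma dual_step_high:
  assumes M: "\<And>i. i \<in> {1..d} \<Longrightarrow> int (c i) \<le> M"
  shows "dual M b \<le> dual (M + 1) b + int k"
proof -
  have "(\<lambda>_. 0) \<in> sols b"
    by (auto simp: sols_def packing_def)
  from val_le_dual[OF this, of "M + 1"] have "0 \<le> dual (M + 1) b"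
    by (simp add: val_def total_def)
  moreover obtain x where x: "x \<in> sols b" "val x - M * total x = dual M b"
    using dual_attained by blast
  moreover have "(\<Sum>i=1..d. (int (c i) - M) * x i) \<le> 0"
    using M x(1) by (intro sum_nonpos mult_nonpos_nonneg) (auto simp: sols_def packing_def)
  ultimately show ?thesis
    unfolding val_minus_total by simp
qed

section \<open>Testing whether an optimal solution can avoid an interval\<close>

definition local_min :: "int \<Rightarrow> bool" where
  "local_min \<mu> \<longleftrightarrow> dual \<mu> (int j - 1) + int k \<le> dual (\<mu> - 1) (int j - 1) \<and>
     dual \<mu> (int j - 1) \<le> dual (\<mu> + 1) (int j - 1) + int k"

definition avoidable :: "int \<Rightarrow> bool" where
  "avoidable b \<longleftrightarrow> (\<exists>u. optimal_solution \<Delta> d c k u \<and> (\<forall>i\<in>{1..d} \<inter> blocked b. u i = 0))"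

text \<open>The value meets the weak duality bound of the unrestricted problem, whatever interval
  \<open>x\<close> itself avoids.\<close>

lemma optimal_of_sol:
  assumes "x \<in> sols b" "total x = int k" "val x = dual \<mu> (int j - 1) + \<mu> * int k"
  shows "optimal_solution \<Delta> d c k (\<lambda>i. real_of_int (x i))"
  unfolding optimal_solution_def
proof (intro conjI ballI allI impI)
  show "feasible \<Delta> d k (\<lambda>i. real_of_int (x i))"
    using feasible_of_sol assms by blast
  fix v assume "feasible \<Delta> d k v"
  then show "objective d c v \<le> objective d c (\<lambda>i. real_of_int (x i))"
    using objective_le_dual[of k v "int j - 1" \<mu>] assms(3) by (simp add: objective_of_int blocked_empty)
next
  fix i assume i: "i \<in> {1..d}"
  have "0 \<le> x i" "x i \<le> 1"
    using assms(1) packing_le_1[OF _ \<Delta> i, of x] i by (auto simp: sols_def packing_def)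
  then have "x i = 0 \<or> x i = 1"
    by auto
  then show "real_of_int (x i) \<in> {0, 1}"
    by auto
qed

lemma objective_optimal:
  assumes "local_min \<mu>" "optimal_solution \<Delta> d c k u"
  shows "objective d c u = real_of_int (dual \<mu> (int j - 1) + \<mu> * int k)"
proof (rule antisym)
  obtain x where x: "x \<in> sols (int j - 1)" "total x = int k" "val x = dual \<mu> (int j - 1) + \<mu> * int k"
    using strong_duality[of \<mu> "int j - 1"] assms(1) by (auto simp: local_min_def)
  show "objective d c u \<le> real_of_int (dual \<mu> (int j - 1) + \<mu> * int k)"
    using objective_le_dual[of k u "int j - 1" \<mu>] assms(2)
    by (simp add: blocked_empty optimal_solution_def)
  show "real_of_int (dual \<mu> (int j - 1) + \<mu> * int k) \<le> objective d c u"
    using assms(2) feasible_of_sol[OF x(1,2)] objective_of_int[of x] x(3)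
    by (auto simp: optimal_solution_def)
qed

text \<open>If the optimum survives the blocking, weak duality for the blocked problem at the three
  multipliers gives the inequalities. Conversely, they make \<open>\<mu>\<close> a local minimum of
  the blocked problem with the same dual value, and strong duality yields the solution.\<close>

lemma avoidable_iff:
  assumes "local_min \<mu>"
  shows "avoidable b \<longleftrightarrow> dual \<mu> (int j - 1) + int k \<le> dual (\<mu> - 1) b \<and>
     dual \<mu> (int j - 1) \<le> dual \<mu> b \<and> dual \<mu> (int j - 1) \<le> dual (\<mu> + 1) b + int k"
proof
  assume "avoidable b"
  then obtain u where u: "optimal_solution \<Delta> d c k u" "\<forall>i\<in>{1..d} \<inter> blocked b. u i = 0"
    by (auto simp: avoidable_def)
  have le: "dual \<mu> (int j - 1) + \<mu> * int k \<le> dual \<nu> b + \<nu> * int k" for \<nu>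
  proof -
    have "real_of_int (dual \<mu> (int j - 1) + \<mu> * int k) \<le> real_of_int (dual \<nu> b + \<nu> * int k)"
      using objective_le_dual[of k u b \<nu>] u objective_optimal[OF assms u(1)]
      by (simp add: optimal_solution_def)
    then show ?thesis
      by (simp only: of_int_le_iff)
  qed
  show "dual \<mu> (int j - 1) + int k \<le> dual (\<mu> - 1) b \<and>
     dual \<mu> (int j - 1) \<le> dual \<mu> b \<and> dual \<mu> (int j - 1) \<le> dual (\<mu> + 1) b + int k"
    using le[of "\<mu> - 1"] le[of \<mu>] le[of "\<mu> + 1"] by (simp add: algebra_simps)
next
  assume a: "dual \<mu> (int j - 1) + int k \<le> dual (\<mu> - 1) b \<and>
     dual \<mu> (int j - 1) \<le> dual \<mu> b \<and> dual \<mu> (int j - 1) \<le> dual (\<mu> + 1) b + int k"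
  obtain x where x: "x \<in> sols b" "val x - \<mu> * total x = dual \<mu> b"
    using dual_attained by blast
  then have "x \<in> sols (int j - 1)"
    by (auto simp: sols_def blocked_empty)
  \<comment> \<open>Blocking can only lower the dual value, so the middle inequality is an
    equality.\<close>
  then have eq: "dual \<mu> b = dual \<mu> (int j - 1)"
    using val_le_dual[of x "int j - 1" \<mu>] x(2) a by simp
  obtain z where z: "z \<in> sols b" "total z = int k" "val z = dual \<mu> (int j - 1) + \<mu> * int k"
    using strong_duality[of \<mu> b] a eq by auto
  show "avoidable b"
    unfolding avoidable_def using optimal_of_sol[OF z] z(1)
    by (intro exI[of _ "\<lambda>i. real_of_int (z i)"]) (auto simp: sols_def)
qed

lemma avoidable_start:
  assumes "local_min \<mu>"
  shows "avoidable (int j - 1)"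
  using assms by (auto simp: avoidable_iff[OF assms] local_min_def)

lemma avoidable_window_iff:
  "avoidable (int (min (j + \<Delta> - 1) d)) \<longleftrightarrow>
    \<not> (\<forall>u. optimal_solution \<Delta> d c k u \<longrightarrow> (\<exists>i\<in>{j..min (j + \<Delta> - 1) d}. u i = 1))"
proof -
  have "{1..d} \<inter> blocked (int (min (j + \<Delta> - 1) d)) = {j..min (j + \<Delta> - 1) d}"
    using j by (auto simp: blocked_def)
  then have "(\<forall>i\<in>{1..d} \<inter> blocked (int (min (j + \<Delta> - 1) d)). u i = 0) \<longleftrightarrow>
      \<not> (\<exists>i\<in>{j..min (j + \<Delta> - 1) d}. u i = 1)" if "optimal_solution \<Delta> d c k u" for u
    using that j by (force simp: optimal_solution_def)
  then show ?thesis
    unfolding avoidable_def by blast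
qed

lemma avoidable_boundary:
  assumes "avoidable b" "\<not> avoidable (b + 1)" "int j - 1 \<le> b" "b < int d"
  shows "\<exists>i. int i = b + 1 \<and> (\<exists>u. optimal_solution \<Delta> d c k u \<and> u i = 1)"
proof -
  define i where "i = nat (b + 1)"
  have i: "int i = b + 1" "i \<in> {1..d}"
    using assms(3,4) j by (auto simp: i_def)
  obtain u where u: "optimal_solution \<Delta> d c k u" "\<forall>i\<in>{1..d} \<inter> blocked b. u i = 0"
    using assms(1) by (auto simp: avoidable_def)
  \<comment> \<open>Only \<open>i\<close> is newly blocked, so \<open>u i = 0\<close> would make
    \<open>u\<close> a witness for \<open>avoidable (b + 1)\<close>.\<close>
  have "blocked (b + 1) = insert i (blocked b)"
    using i(1) assms(3) by (auto simp: blocked_def)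
  then have "u i \<noteq> 0"
    using assms(2) u by (auto simp: avoidable_def)
  then have "u i = 1"
    using u(1) i(2) by (auto simp: optimal_solution_def)
  then show ?thesis
    using u(1) i(1) by blast
qed

end

section \<open>Running times of programs\<close>

text \<open>Total correctness with the running time passed to the postcondition. As
  \<open>exec\<close> is deterministic, the existential speaks about the only run.\<close>

definition wp :: "com \<Rightarrow> (nat \<Rightarrow> state \<Rightarrow> bool) \<Rightarrow> state \<Rightarrow> bool" where
  "wp p Q s \<longleftrightarrow> (\<exists>t s'. exec p s t s' \<and> Q t s')"

lemma wp_mono: "wp p Q s \<Longrightarrow> (\<And>t s'. Q t s' \<Longrightarrow> R t s') \<Longrightarrow> wp p R s"
  unfolding wp_def by blast

lemma wp_Skip [simp]: "wp Skip Q s \<longleftrightarrow> Q 1 s"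
  unfolding wp_def by (metis exec.Skip exec_SkipE)

lemma wp_Assign [simp]:
  "wp (Assign x e) Q s \<longleftrightarrow> Q (acost e + 1) ((fst s)(x := aval e s), snd s)"
proof -
  have "set_var x (aval e s) s = ((fst s)(x := aval e s), snd s)"
    by (cases s) simp
  then show ?thesis
    unfolding wp_def using exec.Assign[of x e s] by (metis exec_AssignE)
qed

lemma wp_Write [simp]:
  "wp (Write a e f) Q s \<longleftrightarrow> Q (acost e + acost f + 1)
     (fst s, (snd s)(a := (snd s a)(aval e s := aval f s)))"
proof -
  have "set_arr a (aval e s) (aval f s) s = (fst s, (snd s)(a := (snd s a)(aval e s := aval f s)))"
    by (cases s) simp
  then show ?thesis
    unfolding wp_def using exec.Write[of a e f s] by (metis exec_WriteE)
qed

lemma wp_Seq [simp]: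
  "wp (Seq p q) Q s \<longleftrightarrow> wp p (\<lambda>t s'. wp q (\<lambda>t'. Q (t + t' + 1)) s') s"
proof -
  have *: "exec (Seq p q) s t s'' \<longleftrightarrow>
      (\<exists>t1 s' t2. t = t1 + t2 + 1 \<and> exec p s t1 s' \<and> exec q s' t2 s'')" for t s''
    using exec.Seq[of p s _ _ q _ s''] by (fastforce elim!: exec_SeqE)
  show ?thesis
    unfolding wp_def * by fast
qed

lemma wp_Cond [simp]:
  "wp (Cond b p q) Q s \<longleftrightarrow> (if bval b s then wp p (\<lambda>t. Q (bcost b + t + 1)) s
     else wp q (\<lambda>t. Q (bcost b + t + 1)) s)"
  proof -
  have "exec (Cond b p q) s t s' \<longleftrightarrow>
      (\<exists>t'. t = bcost b + t' + 1 \<and> exec (if bval b s then p else q) s t' s')" for t s'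
    using exec.CondTrue[of b s p _ s' q] exec.CondFalse[of b s q _ s' p] by (auto elim!: exec_CondE)
  then show ?thesis
    unfolding wp_def by auto
qed

text \<open>The index of \<open>I\<close> is a budget of iterations, of which each pass uses one.
  The step hypothesis also excludes a true guard at budget 0, and the loop may stop with budget
  left.\<close>

lemma wp_While:
  assumes step: "\<And>n s. I n s \<Longrightarrow> bval b s \<Longrightarrow> \<exists>n'. n = Suc n' \<and> wp p (\<lambda>t s'. t \<le> T \<and> I n' s') s"
    and "I n s"
  shows "wp (While b p) (\<lambda>t s'. t \<le> n * (T + bcost b + 1) + bcost b + 1 \<and>
    \<not> bval b s' \<and> (\<exists>m. I m s')) s"
  using assms(2)
proof (induction n arbitrary: s rule: less_induct)
  case (less n)
  show ?case
  proof (cases "bval b s")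
    case False
    then show ?thesis
      unfolding wp_def using less.prems exec.WhileFalse[OF False, of p]
      by (intro exI[of _ "bcost b + 1"] exI[of _ s]) auto
  next
    case True
    obtain n' t s' where n: "n = Suc n'" and *: "exec p s t s'" "t \<le> T" "I n' s'"
      using step[OF less.prems True] by (auto simp: wp_def)
    obtain t' s'' where **: "exec (While b p) s' t' s''"
      "t' \<le> n' * (T + bcost b + 1) + bcost b + 1" "\<not> bval b s''" "\<exists>m. I m s''"
      using less.IH[OF _ *(3)] n by (auto simp: wp_def)
    have "exec (While b p) s (bcost b + t + t' + 1) s''"
      using True *(1) **(1) by (rule exec.WhileTrue)
    then show ?thesis
      unfolding wp_def using **(2-4) *(2) n
      by (intro exI[of _ "bcost b + t + t' + 1"] exI[of _ s'']) auto
  qed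
qed

section \<open>The algorithm\<close>

notation Seq (infixr ";;" 60)

definition maximum_prog :: com where
  "maximum_prog =
     Assign ''i'' (Const 1) ;;
     While (BNot (BLess (Var ''d'') (Var ''i'')))
       (Cond (BLess (Var ''m'') (Read ''c'' (Var ''i''))) (Assign ''m'' (Read ''c'' (Var ''i''))) Skip ;;
        Assign ''i'' (Plus (Var ''i'') (Const 1)))"

text \<open>An optimal multiplier exceeds \<open>- k * m\<close>; in the absence of multiplication, doubling provides
  the bound \<open>L\<close> on \<open>k * m\<close>.\<close>

definition scale_prog :: com where
  "scale_prog =
     Assign ''L'' (Plus (Var ''m'') (Const 1)) ;;
     Assign ''n'' (Var ''k'') ;;
     While (BLess (Const 0) (Var ''n''))
       (Assign ''L'' (Plus (Var ''L'') (Var ''L'')) ;;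
        Assign ''n'' (Half (Var ''n'')))"

text \<open>Tabulates \<open>opt_value\<close> in \<open>F\<close> for multiplier \<open>l\<close>
  and bound \<open>b\<close>. Cells at non-positive indices stay 0, which replaces the truncated
  subtraction.\<close>

definition dual_prog :: com where
  "dual_prog =
     Assign ''i'' (Const 1) ;;
     While (BNot (BLess (Var ''d'') (Var ''i'')))
       (Assign ''x'' (Read ''F'' (Minus (Var ''i'') (Const 1))) ;;
        Cond (BAnd (BNot (BLess (Var ''i'') (Var ''j''))) (BNot (BLess (Var ''b'') (Var ''i''))))
          Skip
          (Assign ''y'' (Plus (Read ''F'' (Minus (Var ''i'') (Var ''Delta'')))
             (Minus (Read ''c'' (Var ''i'')) (Var ''l''))) ;;
           Cond (BLess (Var ''x'') (Var ''y'')) (Assign ''x'' (Var ''y'')) Skip) ;;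
        Write ''F'' (Var ''i'') (Var ''x'') ;;
        Assign ''i'' (Plus (Var ''i'') (Const 1))) ;;
     Assign ''g'' (Read ''F'' (Var ''d''))"

text \<open>For a feasible instance the dual falls by at least \<open>k\<close> from
  \<open>lo\<close> to \<open>lo + 1\<close>; it always falls by at most \<open>k\<close> from
  \<open>hi\<close> to \<open>hi + 1\<close>. Once \<open>lo\<close> and \<open>hi\<close> are
  adjacent, \<open>hi\<close> is the multiplier sought.\<close>

definition multiplier_prog :: com where
  "multiplier_prog =
     Assign ''b'' (Minus (Var ''j'') (Const 1)) ;;
     Assign ''lo'' (Minus (Minus (Const 0) (Var ''L'')) (Const 1)) ;;
     Assign ''hi'' (Var ''m'') ;;
     While (BLess (Plus (Var ''lo'') (Const 1)) (Var ''hi''))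
       (Assign ''l'' (Half (Plus (Var ''lo'') (Var ''hi''))) ;;
        dual_prog ;;
        Assign ''h'' (Var ''g'') ;;
        Assign ''l'' (Plus (Var ''l'') (Const 1)) ;;
        dual_prog ;;
        Cond (BLess (Var ''h'') (Plus (Var ''g'') (Var ''k'')))
          (Assign ''hi'' (Minus (Var ''l'') (Const 1)))
          (Assign ''lo'' (Minus (Var ''l'') (Const 1)))) ;;
     Assign ''l'' (Var ''hi'') ;;
     dual_prog ;;
     Assign ''G'' (Var ''g'')"

text \<open>For a feasible instance \<open>p\<close> is always avoidable, and \<open>q\<close> is
  either unavoidable or the sentinel \<open>e + 1\<close>, which is never tested. A surviving
  sentinel means that the whole window is avoidable.\<close>

definition index_prog :: com where
  "index_prog =
     Assign ''e'' (Minus (Plus (Var ''j'') (Var ''Delta'')) (Const 1)) ;;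
     Cond (BLess (Var ''d'') (Var ''e'')) (Assign ''e'' (Var ''d'')) Skip ;;
     Assign ''p'' (Minus (Var ''j'') (Const 1)) ;;
     Assign ''q'' (Plus (Var ''e'') (Const 1)) ;;
     While (BLess (Plus (Var ''p'') (Const 1)) (Var ''q''))
       (Assign ''b'' (Half (Plus (Var ''p'') (Var ''q''))) ;;
        Assign ''l'' (Minus (Var ''hi'') (Const 1)) ;;
        dual_prog ;;
        Assign ''g1'' (Var ''g'') ;;
        Assign ''l'' (Var ''hi'') ;;
        dual_prog ;;
        Assign ''g2'' (Var ''g'') ;;
        Assign ''l'' (Plus (Var ''hi'') (Const 1)) ;;
        dual_prog ;;
        Cond (BAnd (BNot (BLess (Var ''g1'') (Plus (Var ''G'') (Var ''k''))))
               (BAnd (BNot (BLess (Var ''g2'') (Var ''G'')))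
                 (BNot (BLess (Plus (Var ''g'') (Var ''k'')) (Var ''G'')))))
          (Assign ''p'' (Var ''b''))
          (Assign ''q'' (Var ''b''))) ;;
     Cond (BLess (Var ''e'') (Var ''q'')) (Assign ''r'' (Const (-1))) (Assign ''r'' (Var ''q''))"

definition search_prog :: com where
  "search_prog = maximum_prog ;; scale_prog ;; multiplier_prog ;; index_prog"

lemma loop_time:
  fixes n a b d :: nat
  assumes "b \<le> 9" "1 \<le> d"
  shows "n * (a * d + b + 1) + b + 1 \<le> (a + 10) * d * (n + 1)"
proof -
  have "(b + 1) * (n + 1) \<le> (10 * d) * (n + 1)"
    using assms by (intro mult_right_mono) auto
  then show ?thesis
    by (simp add: algebra_simps)
qed

section \<open>Correctness and cost of the subprograms\<close>

context sparse_problem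
begin

definition inp :: "state \<Rightarrow> bool" where
  "inp s \<longleftrightarrow> fst s ''Delta'' = int \<Delta> \<and> fst s ''d'' = int d \<and> fst s ''k'' = int k \<and> fst s ''j'' = int j \<and>
     (\<forall>i\<in>{1..d}. snd s ''c'' (int i) = int (c i)) \<and> (\<forall>i\<le>0. snd s ''F'' i = 0)"

text \<open>The exceptions are the scratch and result registers of \<open>dual_prog\<close>; its
  callers keep their own data elsewhere.\<close>

definition frame :: "state \<Rightarrow> state \<Rightarrow> bool" where
  "frame s s' \<longleftrightarrow> (\<forall>z. z \<notin> {''i'', ''x'', ''y'', ''g''} \<longrightarrow> fst s' z = fst s z)"

lemma frameD: "frame s s' \<Longrightarrow> z \<notin> {''i'', ''x'', ''y'', ''g''} \<Longrightarrow> fst s' z = fst s z"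
  by (simp add: frame_def)

text \<open>The lower bounds on \<open>m\<close> serve correctness; the upper bound limits the
  length of the later binary search.\<close>

lemma wp_maximum_prog:
  assumes "inp s" "fst s ''m'' = 0"
  shows "wp maximum_prog (\<lambda>t s'. t \<le> 100 * d \<and> inp s' \<and> (\<forall>i\<in>{1..d}. int (c i) \<le> fst s' ''m'') \<and>
    0 \<le> fst s' ''m'' \<and> fst s' ''m'' \<le> int (Max (c ` {1..d}))) s"
proof -
  define I where "I n s \<longleftrightarrow> (\<exists>a\<le>d. n = d - a \<and> inp s \<and> fst s ''i'' = int a + 1 \<and>
     (\<forall>i\<in>{1..a}. int (c i) \<le> fst s ''m'') \<and> 0 \<le> fst s ''m'' \<and> fst s ''m'' \<le> int (Max (c ` {1..d})))"
    for n s
  let ?b = "BNot (BLess (Var ''d'') (Var ''i''))"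
  let ?p = "Cond (BLess (Var ''m'') (Read ''c'' (Var ''i''))) (Assign ''m'' (Read ''c'' (Var ''i''))) Skip ;;
        Assign ''i'' (Plus (Var ''i'') (Const 1))"
  let ?s = "((fst s)(''i'' := 1), snd s)"
  have "wp (While ?b
       ?p)
      (\<lambda>t s'. t \<le> d * (20 + bcost ?b + 1) +
         bcost ?b + 1 \<and>
         \<not> bval ?b s' \<and> (\<exists>n. I n s'))
      ?s"
  proof (rule wp_While)
    show "I d ?s"
      unfolding I_def using assms by (intro exI[of _ 0]) (auto simp: inp_def)
  next
    fix n s assume I: "I n s" and b: "bval ?b s"
    then obtain a where a: "a \<le> d" "n = d - a" "inp s" "fst s ''i'' = int a + 1"
       "\<forall>i\<in>{1..a}. int (c i) \<le> fst s ''m''" "0 \<le> fst s ''m''" "fst s ''m'' \<le> int (Max (c ` {1..d}))"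
      by (auto simp: I_def)
    have ad: "a < d"
      using b a by (auto simp: inp_def)
    have c: "snd s ''c'' (int a + 1) = int (c (Suc a))"
      using a(3) ad by (auto simp: inp_def dest!: bspec[of _ _ "Suc a"] simp: add.commute)
    have "c (Suc a) \<le> Max (c ` {1..d})"
      using ad by (intro Max_ge) auto
    moreover have "{1..Suc a} = insert (Suc a) {1..a}"
      by auto
    ultimately have "wp ?p (\<lambda>t s'. t \<le> 20 \<and> I (d - Suc a) s') s"
      using a ad c unfolding I_def
      by (auto simp: inp_def intro!: exI[of _ "Suc a"] dest: bspec)
    then show "\<exists>n'. n = Suc n' \<and> wp ?p (\<lambda>t s'. t \<le> 20 \<and> I n' s') s"
      using a(2) ad by (intro exI[of _ "d - Suc a"]) auto
  qed
  then show ?thesis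
    unfolding maximum_prog_def wp_Seq wp_Assign aval.simps
    by (rule wp_mono) (use j in \<open>auto simp: I_def inp_def\<close>)
qed

lemma wp_scale_prog:
  assumes "inp s" "0 \<le> fst s ''m''" and N: "k < 2 ^ N"
  shows "wp scale_prog (\<lambda>t s'. t \<le> 100 * (N + 1) \<and> inp s' \<and> fst s' ''m'' = fst s ''m'' \<and>
    int k * fst s ''m'' < fst s' ''L'' \<and> fst s' ''L'' \<le> (fst s ''m'' + 1) * 2 ^ N) s"
proof -
  define M where "M = fst s ''m''"
  define I where "I n s \<longleftrightarrow> inp s \<and> fst s ''m'' = M \<and> fst s ''n'' < 2 ^ n \<and> 0 \<le> fst s ''n'' \<and> 0 < fst s ''L'' \<and>
     fst s ''L'' * 2 ^ n \<le> (M + 1) * 2 ^ N \<and> int k * M < fst s ''L'' * (fst s ''n'' + 1)"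
    for n s
  let ?b = "BLess (Const 0) (Var ''n'')"
  let ?p = "Assign ''L'' (Plus (Var ''L'') (Var ''L'')) ;; Assign ''n'' (Half (Var ''n''))"
  let ?s = "((fst s)(''L'' := M + 1, ''n'' := int k), snd s)"
  have "wp (While ?b ?p)
      (\<lambda>t s'. t \<le> N * (20 + bcost ?b + 1) + bcost ?b + 1 \<and> \<not> bval ?b s' \<and> (\<exists>n. I n s')) ?s"
  proof (rule wp_While)
    show "I N ?s"
      using assms unfolding I_def M_def
      by (auto simp: inp_def algebra_simps)
  next
    fix n s assume I: "I n s" and b: "bval ?b s"
    then obtain n' where n: "n = Suc n'"
      by (cases n) (auto simp: I_def)
    \<comment> \<open>Doubling \<open>L\<close> while halving \<open>n\<close> does not decrease
      \<open>L * (n + 1)\<close>, so this product stays above \<open>k * M\<close>; at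
      \<open>n = 0\<close> it is \<open>L\<close>.\<close>
    have "fst s ''L'' * (fst s ''n'' + 1) \<le> fst s ''L'' * (2 * (fst s ''n'' div 2 + 1))"
      using I by (intro mult_left_mono) (auto simp: I_def)
    also have "\<dots> = (fst s ''L'' + fst s ''L'') * (fst s ''n'' div 2 + 1)"
      by (simp add: algebra_simps)
    finally have "wp ?p (\<lambda>t s'. t \<le> 20 \<and> I n' s') s"
      using I n by (auto simp: I_def inp_def algebra_simps)
    with n show "\<exists>n'. n = Suc n' \<and> wp ?p (\<lambda>t s'. t \<le> 20 \<and> I n' s') s"
      by blast
  qed
  then have "wp (While ?b ?p) (\<lambda>t s'. t \<le> 100 * N + 10 \<and> inp s' \<and> fst s' ''m'' = M \<and>
    int k * M < fst s' ''L'' \<and> fst s' ''L'' \<le> (M + 1) * 2 ^ N) ?s"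
  proof (rule wp_mono, elim conjE exE)
    fix t s' n
    assume t: "t \<le> N * (20 + bcost ?b + 1) + bcost ?b + 1" and b: "\<not> bval ?b s'" and I: "I n s'"
    have "fst s' ''L'' * 1 \<le> fst s' ''L'' * 2 ^ n"
      using I by (intro mult_left_mono) (auto simp: I_def)
    then have "fst s' ''L'' \<le> (M + 1) * 2 ^ N"
      using I unfolding I_def by linarith
    moreover have "fst s' ''n'' = 0"
      using b I by (auto simp: I_def)
    ultimately show "t \<le> 100 * N + 10 \<and> inp s' \<and> fst s' ''m'' = M \<and>
        int k * M < fst s' ''L'' \<and> fst s' ''L'' \<le> (M + 1) * 2 ^ N"
      using I t by (auto simp: I_def)
  qed
  moreover have "fst s ''k'' = int k"
    using assms(1) by (simp add: inp_def)
  ultimately show ?thesis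
    unfolding scale_prog_def wp_Seq wp_Assign
    by (simp add: M_def) (erule wp_mono, auto)
qed

lemma wp_dual_prog:
  assumes "inp s"
  shows "wp dual_prog (\<lambda>t s'. t \<le> 100 * d \<and> inp s' \<and> frame s s' \<and>
    fst s' ''g'' = dual (fst s ''l'') (fst s ''b'')) s"
proof -
  define w where "w i = int (c i) - fst s ''l''" for i
  define A where "A = - blocked (fst s ''b'')"
  define I where "I n s' \<longleftrightarrow> (\<exists>a\<le>d. n = d - a \<and> inp s' \<and> frame s s' \<and> fst s' ''i'' = int a + 1 \<and>
     (\<forall>i\<le>a. snd s' ''F'' (int i) = opt_value \<Delta> w A i))"
    for n s'
  let ?b = "BNot (BLess (Var ''d'') (Var ''i''))"
  let ?p = "Assign ''x'' (Read ''F'' (Minus (Var ''i'') (Const 1))) ;;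
        Cond (BAnd (BNot (BLess (Var ''i'') (Var ''j''))) (BNot (BLess (Var ''b'') (Var ''i''))))
          Skip
          (Assign ''y'' (Plus (Read ''F'' (Minus (Var ''i'') (Var ''Delta'')))
             (Minus (Read ''c'' (Var ''i'')) (Var ''l''))) ;;
           Cond (BLess (Var ''x'') (Var ''y'')) (Assign ''x'' (Var ''y'')) Skip) ;;
        Write ''F'' (Var ''i'') (Var ''x'') ;;
        Assign ''i'' (Plus (Var ''i'') (Const 1))"
  let ?s = "((fst s)(''i'' := 1), snd s)"
  have "wp (While ?b ?p)
      (\<lambda>t s'. t \<le> d * (50 + bcost ?b + 1) + bcost ?b + 1 \<and> \<not> bval ?b s' \<and> (\<exists>n. I n s')) ?s"
  proof (rule wp_While)
    show "I d ?s"
      unfolding I_def using assms by (intro exI[of _ 0]) (auto simp: inp_def frame_def)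
  next
    fix n s' assume I: "I n s'" and b: "bval ?b s'"
    then obtain a where a: "a \<le> d" "n = d - a" "inp s'" "frame s s'" "fst s' ''i'' = int a + 1"
        and F: "\<And>i. i \<le> a \<Longrightarrow> snd s' ''F'' (int i) = opt_value \<Delta> w A i"
      by (auto simp: I_def)
    have ad: "a < d"
      using b a by (auto simp: inp_def)
    have c: "snd s' ''c'' (int a + 1) = int (c (Suc a))"
      using a(3) ad by (auto simp: inp_def dest!: bspec[of _ _ "Suc a"] simp: add.commute)
    \<comment> \<open>If \<open>\<Delta> > a\<close>, the program reads a cell at a non-positive
      index, and its 0 agrees with \<open>opt_value\<close> at 0.\<close>
    have prev: "snd s' ''F'' (int a + 1 - int \<Delta>) = opt_value \<Delta> w A (a - (\<Delta> - 1))"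
    proof (cases "\<Delta> \<le> a")
      case True
      then have "int a + 1 - int \<Delta> = int (a - (\<Delta> - 1))"
        using \<Delta> by auto
      then show ?thesis by (simp only:) (rule F, simp)
    next
      case False
      then show ?thesis using a(3) \<Delta> by (auto simp: inp_def)
    qed
    have lb: "fst s' ''l'' = fst s ''l''" "fst s' ''b'' = fst s ''b''"
      using a(4) by (auto intro!: frameD)
    have inA: "Suc a \<in> A \<longleftrightarrow> \<not> (int j \<le> int a + 1 \<and> int a + 1 \<le> fst s ''b'')"
      by (auto simp: A_def blocked_def)
    have D: "fst s' ''Delta'' = int \<Delta>" "fst s' ''j'' = int j"
      using a(3) by (auto simp: inp_def)
    \<comment> \<open>Every branch ends with the same write to \<open>F\<close>; only the value
      \<open>f\<close> has to be checked per branch.\<close>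
    have I': "I (d - Suc a) (v, (snd s')(''F'' := (snd s' ''F'')(int a + 1 := f)))"
      if "f = opt_value \<Delta> w A (Suc a)" "v ''i'' = int a + 2"
        "\<And>z. z \<notin> {''i'', ''x'', ''y'', ''g''} \<Longrightarrow> v z = fst s' z" for v f
    proof -
      have "frame s (v, m)" for m
        using a(4) that(3) by (simp add: frame_def)
      moreover have "inp (v, (snd s')(''F'' := (snd s' ''F'')(int a + 1 := f)))"
        using a(3) that(3) by (simp add: inp_def)
      moreover have "((snd s' ''F'')(int a + 1 := f)) (int i) = opt_value \<Delta> w A i" if "i \<le> Suc a" for i
        using that F[of i] \<open>f = _\<close> by (cases "i = Suc a") auto
      ultimately show ?thesis
        unfolding I_def using that(2) ad by (intro exI[of _ "Suc a"]) simp
    qed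
    note upd = a(5) lb D c inA
    have "wp ?p (\<lambda>t s'. t \<le> 50 \<and> I (d - Suc a) s') s'"
    proof (cases "int j \<le> int a + 1 \<and> int a + 1 \<le> fst s ''b''")
      case True
      then show ?thesis
        by (simp add: upd) (rule I', simp_all add: inA F prev w_def)
    next
      case False
      then show ?thesis
        by (auto simp: upd intro!: I') (simp_all add: inA F prev w_def)
    qed
    then show "\<exists>n'. n = Suc n' \<and> wp ?p (\<lambda>t s'. t \<le> 50 \<and> I n' s') s'"
      using a(2) ad by (intro exI[of _ "d - Suc a"]) auto
  qed
  then have "wp (While ?b ?p) (\<lambda>t s'. t \<le> 70 * d \<and> inp s' \<and> frame s s' \<and>
      snd s' ''F'' (int d) = opt_value \<Delta> w A d) ?s"
    by (rule wp_mono) (use j in \<open>auto simp: I_def inp_def\<close>)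
  then show ?thesis
    unfolding dual_prog_def wp_Seq wp_Assign aval.simps
    by (rule wp_mono) (use j in \<open>auto simp: inp_def frame_def dual_def w_def[abs_def] A_def\<close>)
qed

lemma wp_dual_progI:
  assumes "inp s" and Q: "\<And>t s'. t \<le> 100 * d \<Longrightarrow> inp s' \<Longrightarrow>
    \<forall>z\<in>{''l'', ''b'', ''h'', ''lo'', ''hi'', ''G'', ''e'', ''p'', ''q'', ''g1'', ''g2''}. fst s' z = fst s z \<Longrightarrow>
    fst s' ''g'' = dual (fst s ''l'') (fst s ''b'') \<Longrightarrow> Q t s'"
  shows "wp dual_prog Q s"
  using wp_dual_prog[OF assms(1)] by (rule wp_mono) (rule Q, simp_all add: frame_def)

lemma inp_update [simp]:
  assumes "x \<notin> {''Delta'', ''d'', ''k'', ''j''}"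
  shows "inp (v(x := n), m) \<longleftrightarrow> inp (v, m)"
  using assms by (auto simp: inp_def)

lemma inp_vars:
  assumes "inp s"
  shows "fst s ''Delta'' = int \<Delta>" "fst s ''d'' = int d" "fst s ''k'' = int k" "fst s ''j'' = int j"
  using assms by (auto simp: inp_def)

lemma wp_multiplier_prog:
  assumes "inp s" and M: "\<And>i. i \<in> {1..d} \<Longrightarrow> int (c i) \<le> fst s ''m''" "0 \<le> fst s ''m''"
    and L: "int k * fst s ''m'' < fst s ''L''" and n: "fst s ''m'' + fst s ''L'' + 1 \<le> 2 ^ n"
  shows "wp multiplier_prog (\<lambda>t s'. t \<le> 500 * d * (n + 1) \<and> inp s' \<and>
    ((\<exists>u. feasible \<Delta> d k u) \<longrightarrow> local_min (fst s' ''hi'')) \<and>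
    fst s' ''G'' = dual (fst s' ''hi'') (int j - 1)) s"
proof -
  let ?D = "\<lambda>\<mu>. dual \<mu> (int j - 1)"
  \<comment> \<open>Only the condition at \<open>lo\<close> depends on feasibility, so the time
    bound also covers infeasible instances.\<close>
  define I where "I n s \<longleftrightarrow> inp s \<and> fst s ''b'' = int j - 1 \<and> fst s ''lo'' < fst s ''hi'' \<and>
     fst s ''hi'' - fst s ''lo'' \<le> 2 ^ n \<and>
     ((\<exists>u. feasible \<Delta> d k u) \<longrightarrow> ?D (fst s ''lo'' + 1) + int k \<le> ?D (fst s ''lo'')) \<and>
     ?D (fst s ''hi'') \<le> ?D (fst s ''hi'' + 1) + int k"
    for n s
  let ?b = "BLess (Plus (Var ''lo'') (Const 1)) (Var ''hi'')"
  let ?p = "Assign ''l'' (Half (Plus (Var ''lo'') (Var ''hi''))) ;;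
        dual_prog ;;
        Assign ''h'' (Var ''g'') ;;
        Assign ''l'' (Plus (Var ''l'') (Const 1)) ;;
        dual_prog ;;
        Cond (BLess (Var ''h'') (Plus (Var ''g'') (Var ''k'')))
          (Assign ''hi'' (Minus (Var ''l'') (Const 1)))
          (Assign ''lo'' (Minus (Var ''l'') (Const 1)))"
  let ?s = "((fst s)(''b'' := int j - 1, ''lo'' := - fst s ''L'' - 1, ''hi'' := fst s ''m''), snd s)"
  have "wp (While ?b ?p)
      (\<lambda>t s'. t \<le> n * (300 * d + bcost ?b + 1) + bcost ?b + 1 \<and> \<not> bval ?b s' \<and> (\<exists>n. I n s')) ?s"
  proof (rule wp_While)
    have "0 \<le> int k * fst s ''m''"
      using M(2) by simp
    then have "0 < fst s ''L''"
      using L by simp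
    then show "I n ?s"
      using assms dual_step_low[OF _ M L] dual_step_high[OF M(1), of "int j - 1"]
      by (auto simp: I_def)
  next
    fix n s assume I: "I n s" and b: "bval ?b s"
    then obtain n' where n: "n = Suc n'"
      by (cases n) (auto simp: I_def)
    define \<mu> where "\<mu> = (fst s ''lo'' + fst s ''hi'') div 2"
    have \<mu>: "fst s ''lo'' < \<mu>" "\<mu> < fst s ''hi''" "\<mu> - fst s ''lo'' \<le> 2 ^ n'" "fst s ''hi'' - \<mu> \<le> 2 ^ n'"
      using I b n by (auto simp: I_def \<mu>_def)
    have "wp ?p (\<lambda>t s'. t \<le> 300 * d \<and> I n' s') s"
      apply (simp add: \<mu>_def[symmetric])
      apply (rule wp_dual_progI)
      subgoal using I by (simp add: I_def)
      apply simp
      apply (rule wp_dual_progI)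
      subgoal using I by (simp add: I_def)
      using I \<mu> j apply (auto simp: I_def inp_vars)
      done
    with n show "\<exists>n'. n = Suc n' \<and> wp ?p (\<lambda>t s'. t \<le> 300 * d \<and> I n' s') s"
      by blast
  qed
  then have loop: "wp (While ?b ?p) (\<lambda>t s'. t \<le> 310 * d * (n + 1) \<and> inp s' \<and> fst s' ''b'' = int j - 1 \<and>
    ((\<exists>u. feasible \<Delta> d k u) \<longrightarrow> local_min (fst s' ''hi''))) ?s"
  proof (rule wp_mono, elim conjE exE)
    fix t s' i
    assume t: "t \<le> n * (300 * d + bcost ?b + 1) + bcost ?b + 1" and b: "\<not> bval ?b s'" and I: "I i s'"
    \<comment> \<open>Now the conditions at \<open>lo\<close> and \<open>hi\<close> are the two
      halves of \<open>local_min\<close>.\<close>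
    have "fst s' ''hi'' = fst s' ''lo'' + 1"
      using b I by (auto simp: I_def)
    moreover have "t \<le> (300 + 10) * d * (n + 1)"
      using t by (rule order_trans) (rule loop_time, use j in auto)
    ultimately show "t \<le> 310 * d * (n + 1) \<and> inp s' \<and> fst s' ''b'' = int j - 1 \<and>
        ((\<exists>u. feasible \<Delta> d k u) \<longrightarrow> local_min (fst s' ''hi''))"
      using I by (auto simp: I_def local_min_def)
  qed
  show ?thesis
    unfolding multiplier_prog_def
    using loop j apply (simp add: inp_vars[OF assms(1)])
    apply (erule wp_mono)
    apply (rule wp_dual_progI)
    apply (auto simp: mult.assoc)
    done
qed

lemma avoidable_antimono:
  assumes "avoidable b" "b' \<le> b"
  shows "avoidable b'"
  using assms unfolding avoidable_def blocked_def by fastforce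

lemma wp_index_prog:
  assumes "inp s" and lm: "(\<exists>u. feasible \<Delta> d k u) \<longrightarrow> local_min (fst s ''hi'')"
    and G: "fst s ''G'' = dual (fst s ''hi'') (int j - 1)" and n: "\<Delta> + 1 \<le> 2 ^ n"
  shows "wp index_prog (\<lambda>t s'. t \<le> 500 * d * (n + 1) \<and> ((\<exists>u. feasible \<Delta> d k u) \<longrightarrow>
    (if avoidable (int (min (j + \<Delta> - 1) d)) then fst s' ''r'' = - 1 
     else \<exists>i\<in>{j..min (j + \<Delta> - 1) d}. fst s' ''r'' = int i \<and> (\<exists>u. optimal_solution \<Delta> d c k u \<and> u i = 1)))) s"
proof -
  define E where "E = int (min (j + \<Delta> - 1) d)"
  define \<mu> where "\<mu> = fst s ''hi''"
  let ?F = "\<exists>u. feasible \<Delta> d k u"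
  define I where "I n s \<longleftrightarrow> inp s \<and> fst s ''hi'' = \<mu> \<and> fst s ''G'' = dual \<mu> (int j - 1) \<and> fst s ''e'' = E \<and>
     int j - 1 \<le> fst s ''p'' \<and> fst s ''p'' < fst s ''q'' \<and> fst s ''q'' \<le> E + 1 \<and>
     fst s ''q'' - fst s ''p'' \<le> 2 ^ n \<and>
     (?F \<longrightarrow> avoidable (fst s ''p'') \<and> (fst s ''q'' = E + 1 \<or> \<not> avoidable (fst s ''q'')))"
    for n s
  let ?b = "BLess (Plus (Var ''p'') (Const 1)) (Var ''q'')"
  let ?p = "Assign ''b'' (Half (Plus (Var ''p'') (Var ''q''))) ;;
        Assign ''l'' (Minus (Var ''hi'') (Const 1)) ;;
        dual_prog ;;
        Assign ''g1'' (Var ''g'') ;;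
        Assign ''l'' (Var ''hi'') ;;
        dual_prog ;;
        Assign ''g2'' (Var ''g'') ;;
        Assign ''l'' (Plus (Var ''hi'') (Const 1)) ;;
        dual_prog ;;
        Cond (BAnd (BNot (BLess (Var ''g1'') (Plus (Var ''G'') (Var ''k''))))
               (BAnd (BNot (BLess (Var ''g2'') (Var ''G'')))
                 (BNot (BLess (Plus (Var ''g'') (Var ''k'')) (Var ''G'')))))
          (Assign ''p'' (Var ''b''))
          (Assign ''q'' (Var ''b''))"
  let ?s = "((fst s)(''e'' := E, ''p'' := int j - 1, ''q'' := E + 1), snd s)"
  have E: "E \<le> int d" "E \<le> int j + int \<Delta> - 1" "int j \<le> E"
    using j \<Delta> by (auto simp: E_def)
  have "wp (While ?b ?p)
      (\<lambda>t s'. t \<le> n * (400 * d + bcost ?b + 1) + bcost ?b + 1 \<and> \<not> bval ?b s' \<and> (\<exists>n. I n s')) ?s"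
  proof (rule wp_While)
    \<comment> \<open>The initial distance is \<open>E + 1 - (j - 1)\<close>, which is at most
      \<open>\<Delta> + 1\<close>.\<close>
    have "int (\<Delta> + 1) \<le> 2 ^ n"
      using n by (metis of_nat_le_iff of_nat_numeral of_nat_power)
    then show "I n ?s"
      using assms E avoidable_start by (auto simp: I_def \<mu>_def)
  next
    fix n s assume I: "I n s" and b: "bval ?b s"
    then obtain n' where n: "n = Suc n'"
      by (cases n) (auto simp: I_def)
    define \<beta> where "\<beta> = (fst s ''p'' + fst s ''q'') div 2"
    have \<beta>: "fst s ''p'' < \<beta>" "\<beta> < fst s ''q''" "\<beta> - fst s ''p'' \<le> 2 ^ n'" "fst s ''q'' - \<beta> \<le> 2 ^ n'"
      using I b n by (auto simp: I_def \<beta>_def)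
    have av: "?F \<longrightarrow> (avoidable \<beta> \<longleftrightarrow> dual \<mu> (int j - 1) + int k \<le> dual (\<mu> - 1) \<beta> \<and>
     dual \<mu> (int j - 1) \<le> dual \<mu> \<beta> \<and> dual \<mu> (int j - 1) \<le> dual (\<mu> + 1) \<beta> + int k)"
      using avoidable_iff lm by (simp add: \<mu>_def)
    have "wp ?p (\<lambda>t s'. t \<le> 400 * d \<and> I n' s') s"
      apply (simp add: \<beta>_def[symmetric])
      apply (rule wp_dual_progI)
      subgoal using I by (simp add: I_def)
      apply simp
      apply (rule wp_dual_progI)
      subgoal using I by (simp add: I_def)
      apply simp
      apply (rule wp_dual_progI)
      subgoal using I by (simp add: I_def)
      using I \<beta> j av apply (simp add: I_def inp_vars)
      done
    with n show "\<exists>n'. n = Suc n' \<and> wp ?p (\<lambda>t s'. t \<le> 400 * d \<and> I n' s') s"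
      by blast
  qed
  then have loop: "wp (While ?b ?p) (\<lambda>t s'. t \<le> 410 * d * (n + 1) \<and> fst s' ''e'' = E \<and> fst s' ''q'' \<le> E + 1 \<and>
    int j \<le> fst s' ''q'' \<and>
    (?F \<longrightarrow> avoidable (fst s' ''q'' - 1) \<and> (fst s' ''q'' = E + 1 \<or> \<not> avoidable (fst s' ''q'')))) ?s"
  proof (rule wp_mono, elim conjE exE)
    fix t s' i
    assume t: "t \<le> n * (400 * d + bcost ?b + 1) + bcost ?b + 1" and b: "\<not> bval ?b s'" and I: "I i s'"
    have "fst s' ''p'' = fst s' ''q'' - 1"
      using b I by (auto simp: I_def)
    moreover have "t \<le> (400 + 10) * d * (n + 1)"
      using t by (rule order_trans) (rule loop_time, use j in auto)
    ultimately show "t \<le> 410 * d * (n + 1) \<and> fst s' ''e'' = E \<and> fst s' ''q'' \<le> E + 1 \<and>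
        int j \<le> fst s' ''q'' \<and>
        (?F \<longrightarrow> avoidable (fst s' ''q'' - 1) \<and> (fst s' ''q'' = E + 1 \<or> \<not> avoidable (fst s' ''q'')))"
      using I by (auto simp: I_def)
  qed
  define R where "R r \<longleftrightarrow> (if avoidable (int (min (j + \<Delta> - 1) d)) then r = - 1
     else \<exists>i\<in>{j..min (j + \<Delta> - 1) d}. r = int i \<and> (\<exists>u. optimal_solution \<Delta> d c k u \<and> u i = 1))" for r
  have post: "R (if E < q then - 1 else q)"
    if h: "q \<le> E + 1" "int j \<le> q" "avoidable (q - 1)" "q = E + 1 \<or> \<not> avoidable q" for q
  proof (cases "q = E + 1")
    case True
    then show ?thesis using h by (simp add: R_def E_def)
  next
    case False
    then have q: "q \<le> E" "\<not> avoidable q"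
      using h by auto
    obtain i u where i: "int i = q" "optimal_solution \<Delta> d c k u" "u i = 1"
      using avoidable_boundary[of "q - 1"] h q E by auto
    have "i \<in> {j..min (j + \<Delta> - 1) d}"
      using i(1) q(1) h(2) by (simp add: E_def flip: i(1))
    \<comment> \<open>Blocking more indices cannot help, so \<open>E\<close> inherits unavoidability
      from \<open>q\<close>.\<close>
    moreover have "\<not> avoidable E"
      using q h(2) avoidable_antimono[of E q] by auto
    ultimately show ?thesis
      unfolding R_def E_def[symmetric] using i q(1) by auto
  qed
  have loop': "wp (While ?b ?p) (\<lambda>t s'. t \<le> 410 * d * (n + 1) \<and>
      (?F \<longrightarrow> R (if fst s' ''e'' < fst s' ''q'' then - 1 else fst s' ''q''))) ?s"
    using loop by (rule wp_mono) (elim conjE, intro conjI impI, assumption, simp only: post)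
  have start: "(if int d < int j + int \<Delta> - 1 then int d else int j + int \<Delta> - 1) = E"
    using j \<Delta> by (auto simp: E_def)
  have "wp index_prog (\<lambda>t s'. t \<le> 500 * d * (n + 1) \<and> (?F \<longrightarrow> R (fst s' ''r''))) s"
  proof (cases "int d < int j + int \<Delta> - 1")
    case True
    then have e: "E = int d"
      using start by simp
    show ?thesis
      unfolding index_prog_def using loop' j True unfolding e
      apply (simp add: inp_vars[OF assms(1)])
      apply (erule wp_mono)
      apply (auto simp: mult.assoc)
      done
  next
    case False
    then have e: "E = int j + int \<Delta> - 1"
      using start by simp
    show ?thesis
      unfolding index_prog_def using loop' j False unfolding e
      apply (simp add: inp_vars[OF assms(1)])
      apply (erule wp_mono)
      apply (auto simp: mult.assoc)
      done
  qed
  then show ?thesis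
    by (simp only: R_def)
qed

lemma wp_search_prog:
  assumes M: "Max (c ` {1..d}) + 1 < 2 ^ M" and N: "k < 2 ^ N" and D: "\<Delta> < 2 ^ D"
  shows "wp search_prog (\<lambda>t s. t \<le> 2000 * d * (M + N + D + 1) \<and> ((\<exists>u. feasible \<Delta> d k u) \<longrightarrow>
    (if avoidable (int (min (j + \<Delta> - 1) d)) then fst s ''r'' = - 1
     else \<exists>i\<in>{j..min (j + \<Delta> - 1) d}. fst s ''r'' = int i \<and> (\<exists>u. optimal_solution \<Delta> d c k u \<and> u i = 1))))
    (input_state \<Delta> d c k j)"
  unfolding search_prog_def wp_Seq
proof (rule wp_mono[OF wp_maximum_prog], goal_cases)
  case 1
  then show ?case by (auto simp: inp_def input_state_def)
next
  case 2
  then show ?case by (simp add: input_state_def)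
next
  case (3 t1 s1)
  then show ?case
  proof (elim conjE, intro wp_mono[OF wp_scale_prog[OF _ _ N]], goal_cases)
    case (3 t2 s2)
    have "int (Max (c ` {1..d}) + 1) < 2 ^ M"
      using M by (metis of_nat_less_iff of_nat_numeral of_nat_power)
    then have m: "fst s1 ''m'' + 1 \<le> 2 ^ M"
      using 3 by simp
    \<comment> \<open>The initial search range for the multiplier has length
      \<open>m + L + 1\<close>, so about \<open>M + N\<close> halvings suffice.\<close>
    have "fst s2 ''m'' + fst s2 ''L'' + 1 \<le> (fst s1 ''m'' + 1) * (2 ^ N + 1)"
      using 3 by (simp add: algebra_simps)
    also have "\<dots> \<le> 2 ^ M * 2 ^ (N + 1)"
      using 3 m by (intro mult_mono) auto
    finally have n: "fst s2 ''m'' + fst s2 ''L'' + 1 \<le> 2 ^ (M + N + 1)"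
      by (simp add: power_add)
    from 3 show ?case
    proof (elim conjE, intro wp_mono[OF wp_multiplier_prog[OF _ _ _ _ n]], goal_cases)
      case (5 t3 s3)
      then show ?case
      proof (elim conjE, intro wp_mono[OF wp_index_prog[where n = D]], goal_cases)
        case (5 t4 s4)
        \<comment> \<open>The doubling loop costs no factor \<open>d\<close>;
          \<open>d \<ge> 1\<close> absorbs it into the bound.\<close>
        have "(N + 2) * 100 \<le> (N + 2) * 100 * d"
          using j by simp
        moreover have "t1 \<le> 100 * d" "t2 \<le> 100 * (N + 1)" "t3 \<le> 500 * d * (M + N + 1 + 1)"
            "t4 \<le> 500 * d * (D + 1)"
          using 5 by blast+
        ultimately have "t1 + (t2 + (t3 + t4 + 1) + 1) + 1 \<le> 2000 * d * (M + N + D + 1)"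
          by (simp add: algebra_simps)
        then show ?case using 5 by blast
      qed (use D in auto)
    qed auto
  qed auto
qed

end

section \<open>From bit lengths to the logarithmic time bound\<close>

lemma ex_power2_gt:
  fixes n :: nat
  assumes "1 \<le> n"
  shows "\<exists>N. n < 2 ^ N \<and> real N \<le> log 2 (real n) + 1"
proof (intro exI conjI)
  let ?N = "Suc (nat \<lfloor>log 2 (real n)\<rfloor>)"
  have "0 \<le> log 2 (real n)"
    using assms by simp
  then have N: "log 2 (real n) < real ?N" "real ?N \<le> log 2 (real n) + 1"
    by linarith+
  have "real n < 2 powr real ?N"
    using N(1) assms by (simp only: log_less_iff)
  also have "\<dots> = real (2 ^ ?N)"
    by (simp only: powr_realpow of_nat_power of_nat_numeral)
  finally show "n < 2 ^ ?N"
    by (simp only: of_nat_less_iff)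
  show "real ?N \<le> log 2 (real n) + 1"
    by (rule N(2))
qed

text \<open>Without a feasible point the condition on all optimal solutions holds vacuously while no
  \<open>r\<close> can qualify; hence the output is specified for feasible instances only, the
  running time for all.\<close>

theorem theorem10:
  "\<exists>(p :: com) (C :: real). \<forall>(\<Delta> :: nat) (d :: nat) (c :: nat \<Rightarrow> nat) (k :: nat) (j :: nat).
     1 \<le> \<Delta> \<longrightarrow> 1 \<le> k \<longrightarrow> j \<in> {1..d} \<longrightarrow>
     (\<exists>t s. exec p (input_state \<Delta> d c k j) t s \<and>
        real t \<le> C * time_bound \<Delta> d c k \<and>
        ((\<exists>u. feasible \<Delta> d k u) \<longrightarrow>
          (let J = {j..min (j + \<Delta> - 1) d}; r = output_of s in
            if \<forall>u. optimal_solution \<Delta> d c k u \<longrightarrow> (\<exists>i\<in>J. u i = 1)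
            then \<exists>i\<in>J. r = int i \<and> (\<exists>u. optimal_solution \<Delta> d c k u \<and> u i = 1)
            else r = -1)))"
proof (intro exI[of _ search_prog] exI[of _ "12000 :: real"] allI impI)
  fix \<Delta> d k j :: nat and c :: "nat \<Rightarrow> nat"
  assume h: "1 \<le> \<Delta>" "1 \<le> k" "j \<in> {1..d}"
  interpret sparse_problem \<Delta> d k j c
    using h by unfold_locales
  let ?X = "Max (c ` {1..d})"
  obtain M where M: "?X + 1 < 2 ^ M" "real M \<le> log 2 (real (?X + 1)) + 1"
    using ex_power2_gt[of "?X + 1"] by auto
  obtain N where N: "k < 2 ^ N" "real N \<le> log 2 (real k) + 1"
    using ex_power2_gt[of k] h by auto
  obtain D where D: "\<Delta> < 2 ^ D" "real D \<le> log 2 (real \<Delta>) + 1"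
    using ex_power2_gt[of \<Delta>] h by auto
  obtain t s where ts: "exec search_prog (input_state \<Delta> d c k j) t s"
      "t \<le> 2000 * d * (M + N + D + 1)"
      "(\<exists>u. feasible \<Delta> d k u) \<longrightarrow>
        (if avoidable (int (min (j + \<Delta> - 1) d)) then fst s ''r'' = - 1
         else \<exists>i\<in>{j..min (j + \<Delta> - 1) d}. fst s ''r'' = int i \<and> (\<exists>u. optimal_solution \<Delta> d c k u \<and> u i = 1))"
    using wp_search_prog[OF M(1) N(1) D(1)] unfolding wp_def by (elim exE conjE)
  define A where "A = max 1 (log 2 (real \<Delta>))"
  define B where "B = max 1 (log 2 (real ?X + 1) + log 2 (real k))"
  have AB: "1 \<le> A" "1 \<le> B"
    by (auto simp: A_def B_def)
  \<comment> \<open>The searches run one after the other, so logarithms add up to at most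
    \<open>A + B + 4\<close>. As both factors are at least 1, this is at most
    \<open>6 * (A * B)\<close>, whence the constant \<open>12000 = 2000 * 6\<close>.\<close>
  have "A \<le> A * B" "B \<le> A * B" "1 \<le> A * B"
    using AB mult_mono[of 1 A 1 B] by auto
  moreover have "real M + real N \<le> B + 2" "real D \<le> A + 1"
    using M(2) N(2) D(2) by (auto simp: A_def B_def add.commute)
  ultimately have "real (M + N + D + 1) \<le> 6 * (A * B)"
    by simp
  then have "real (2000 * d) * real (M + N + D + 1) \<le> real (2000 * d) * (6 * (A * B))"
    by (intro mult_left_mono) auto
  moreover have "real t \<le> real (2000 * d) * real (M + N + D + 1)"
    using ts(2) by (simp only: of_nat_le_iff flip: of_nat_mult)
  ultimately have "real t \<le> 12000 * time_bound \<Delta> d c k"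
    unfolding time_bound_def A_def[symmetric] B_def[symmetric] by (simp add: algebra_simps)
  then show "\<exists>t s. exec search_prog (input_state \<Delta> d c k j) t s \<and>
        real t \<le> 12000 * time_bound \<Delta> d c k \<and>
        ((\<exists>u. feasible \<Delta> d k u) \<longrightarrow>
          (let J = {j..min (j + \<Delta> - 1) d}; r = output_of s in
            if \<forall>u. optimal_solution \<Delta> d c k u \<longrightarrow> (\<exists>i\<in>J. u i = 1)
            then \<exists>i\<in>J. r = int i \<and> (\<exists>u. optimal_solution \<Delta> d c k u \<and> u i = 1)
            else r = -1))"
    using ts(1,3) unfolding avoidable_window_iff Let_def output_of_def
    by (intro exI[of _ t] exI[of _ s] conjI) (auto split: if_splits)
qed

end
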